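(* Let $(X,\mathcal{B},\mu,T)$ be a measure theoretical dynamical system and let $\mathcal{U}$ be a cover of $X$. Then $h_\mu(\mathcal{U})\le h_c(\mathcal{U})$.
   Context: A measure theoretical dynamical system is a four-tuple $(X,\mathcal{B},\mu,T)$, where $(X,\mathcal{B})$ is a standard space (i.e. isomorphic to $[0,1]$ with the Borel $\sigma$-algebra), $\mu$ is a probability measure on $(X,\mathcal{B})$ and $T$ is an invertible measure preserving transformation of $X$. A cover of $X$ is a finite collection of measurable sets whose union is $X$; a partition is a cover whose elements are mutually disjoint. A cover $\mathcal{U}$ is finer than a cover $\mathcal{V}$, written $\mathcal{U}\succeq\mathcal{V}$, if every element of $\mathcal{U}$ is contained in an element of $\mathcal{V}$. The join $\mathcal{U}\vee\mathcal{V}$ is the cover whose elements are the sets $U\cap V$ with $U\in\mathcal{U}$, $V\in\mathcal{V}$; $T^k(\mathcal{U})$ is the cover with elements $T^k(U)$, $U\in\mathcal{U}$; and $\mathcal{U}_0^{n-1}=\mathcal{U}\vee T^{-1}(\mathcal{U})\vee\dots\vee T^{-(n-1)}(\mathcal{U})$. For a partition $\alpha$, $H_\mu(\alpha)=-\sum_{A\in\alpha}\mu(A)\log\mu(A)$, and $h_\mu(\alpha)=\lim_{n}\frac1n H_\mu(\alpha_0^{n-1})$ is the usual measure theoretical entropy of $\alpha$ with respect to $T$. For a cover $\mathcal{V}$, $H_\mu(\mathcal{V})=\inf\{H_\mu(\alpha):\alpha\text{ a partition of }X,\ \alpha\succeq\mathcal{V}\}$. For a cover $\mathcal{U}$, put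 $h_\mu^+(\mathcal{U})=\inf\{h_\mu(\alpha):\alpha\text{ a partition of }X,\ \alpha\succeq\mathcal{U}\}$ and $h_\mu^-(\mathcal{U})=\lim_{n}\frac1n H_\mu(\mathcal{U}_0^{n-1})$ (the limit exists by sub-additivity). These two numbers are equal, and $h_\mu(\mathcal{U})$ denotes their common value. The combinatorial entropy of $\mathcal{U}$ is $h_c(\mathcal{U})=\lim_{n}\frac1n\log\mathcal{N}(\mathcal{U}_0^{n-1})$, where $\mathcal{N}(\mathcal{V})$ is the minimum number of elements of $\mathcal{V}$ needed to cover the whole space $X$ (the limit exists by sub-additivity). The same base of logarithm is used throughout. *)

theory Defs
  imports "HOL-Probability.Probability"
begin

section \<open>Measure theoretical dynamical systems\<close>

definition measurable_isomorphic :: "'a measure \<Rightarrow> 'b measure \<Rightarrow> bool" where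
  "measurable_isomorphic M N \<longleftrightarrow>
     (\<exists>f. bij_betw f (space M) (space N) \<and> f \<in> measurable M N
        \<and> inv_into (space M) f \<in> measurable N M)"

text \<open>Only the measurable structure of \<open>M\<close> matters here. As isomorphy to the unit interval is
  required, countable spaces are excluded.\<close>

definition standard_space :: "'a measure \<Rightarrow> bool" where
  "standard_space M \<longleftrightarrow> measurable_isomorphic M (restrict_space borel {0..1::real})"

locale measure_dynamical_system = prob_space M for M :: "'a measure" +
  fixes T :: "'a \<Rightarrow> 'a"
  assumes standard: "standard_space M"
    and T_bij: "bij_betw T (space M) (space M)"
    and T_measurable: "T \<in> measurable M M"
    and T_inv_measurable: "inv_into (space M) T \<in> measurable M M"
    and T_preserving: "\<And>A. A \<in> sets M \<Longrightarrow> emeasure M (T -` A \<inter> space M) = emeasure M A"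

section \<open>Covers and partitions\<close>

definition is_cover :: "'a measure \<Rightarrow> 'a set set \<Rightarrow> bool" where
  "is_cover M \<U> \<longleftrightarrow> finite \<U> \<and> \<U> \<subseteq> sets M \<and> \<Union>\<U> = space M"

text \<open>In contrast to \<^const>\<open>partition_on\<close>, the empty set may be an element of a partition.\<close>

definition is_partition :: "'a measure \<Rightarrow> 'a set set \<Rightarrow> bool" where
  "is_partition M \<alpha> \<longleftrightarrow> is_cover M \<alpha> \<and> disjoint \<alpha>"

definition finer :: "'a set set \<Rightarrow> 'a set set \<Rightarrow> bool" where
  "finer \<U> \<V> \<longleftrightarrow> (\<forall>U\<in>\<U>. \<exists>V\<in>\<V>. U \<subseteq> V)"

definition cover_join :: "'a set set \<Rightarrow> 'a set set \<Rightarrow> 'a set set" where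
  "cover_join \<U> \<V> = {U \<inter> V | U V. U \<in> \<U> \<and> V \<in> \<V>}"

text \<open>\<open>pullback M T k \<U>\<close> is the cover $T^{-k}(\mathcal U)$.\<close>

definition pullback :: "'a measure \<Rightarrow> ('a \<Rightarrow> 'a) \<Rightarrow> nat \<Rightarrow> 'a set set \<Rightarrow> 'a set set" where
  "pullback M T k \<U> = (\<lambda>U. (T ^^ k) -` U \<inter> space M) ` \<U>"

text \<open>\<open>iter_join M T \<U> n\<close> is the cover $\mathcal U_0^{n-1}$, a join of \<open>n\<close> covers; for \<open>n = 0\<close>
  it is the trivial cover, the neutral element of the join.\<close>

primrec iter_join :: "'a measure \<Rightarrow> ('a \<Rightarrow> 'a) \<Rightarrow> 'a set set \<Rightarrow> nat \<Rightarrow> 'a set set" where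
  "iter_join M T \<U> 0 = {space M}"
| "iter_join M T \<U> (Suc n) = cover_join (iter_join M T \<U> n) (pullback M T n \<U>)"

section \<open>Entropy\<close>

text \<open>The number \<open>b\<close> is the base of the logarithm. The convention \<open>0 * log 0 = 0\<close> holds
  automatically.\<close>

definition partition_entropy :: "real \<Rightarrow> 'a measure \<Rightarrow> 'a set set \<Rightarrow> real" where
  "partition_entropy b M \<alpha> = - (\<Sum>A\<in>\<alpha>. measure M A * log b (measure M A))"

definition dyn_entropy :: "real \<Rightarrow> 'a measure \<Rightarrow> ('a \<Rightarrow> 'a) \<Rightarrow> 'a set set \<Rightarrow> real" where
  "dyn_entropy b M T \<alpha> = lim (\<lambda>n. partition_entropy b M (iter_join M T \<alpha> n) / real n)"

definition cover_entropy :: "real \<Rightarrow> 'a measure \<Rightarrow> 'a set set \<Rightarrow> real" where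
  "cover_entropy b M \<V> = Inf {partition_entropy b M \<alpha> | \<alpha>. is_partition M \<alpha> \<and> finer \<alpha> \<V>}"

definition h_plus :: "real \<Rightarrow> 'a measure \<Rightarrow> ('a \<Rightarrow> 'a) \<Rightarrow> 'a set set \<Rightarrow> real" where
  "h_plus b M T \<U> = Inf {dyn_entropy b M T \<alpha> | \<alpha>. is_partition M \<alpha> \<and> finer \<alpha> \<U>}"

definition h_minus :: "real \<Rightarrow> 'a measure \<Rightarrow> ('a \<Rightarrow> 'a) \<Rightarrow> 'a set set \<Rightarrow> real" where
  "h_minus b M T \<U> = lim (\<lambda>n. cover_entropy b M (iter_join M T \<U> n) / real n)"

text \<open>The common value of \<^const>\<open>h_plus\<close> and \<^const>\<open>h_minus\<close>; no information about it is
  available until these two have been shown to be equal.\<close>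

definition h_mu :: "real \<Rightarrow> 'a measure \<Rightarrow> ('a \<Rightarrow> 'a) \<Rightarrow> 'a set set \<Rightarrow> real" where
  "h_mu b M T \<U> = (THE h. h = h_plus b M T \<U> \<and> h = h_minus b M T \<U>)"

definition cover_number :: "'a measure \<Rightarrow> 'a set set \<Rightarrow> nat" where
  "cover_number M \<V> = Min {card \<W> | \<W>. \<W> \<subseteq> \<V> \<and> \<Union>\<W> = space M}"

definition h_c :: "real \<Rightarrow> 'a measure \<Rightarrow> ('a \<Rightarrow> 'a) \<Rightarrow> 'a set set \<Rightarrow> real" where
  "h_c b M T \<U> = lim (\<lambda>n. log b (real (cover_number M (iter_join M T \<U> n))) / real n)"

end

theory Submission
  imports Defs
begin

text \<open>
  The quantity \<open>h_mu\<close> is the common value of \<open>h_plus\<close> and \<open>h_minus\<close>, so the main part of the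
  proof is that these two agree; after that, the theorem says that \<open>h_minus\<close> is at most
  \<open>h_c\<close>, which is simple. A cover with a subcover of \<open>N\<close> elements is refined by a partition
  into at most \<open>N\<close> cells, whose entropy is at most \<open>log N\<close>
  (\<open>cover_entropy_le_log_cover_number\<close>). Applied to the iterated joins, after division by
  \<open>n\<close> and passage to the limit, this is \<open>h_minus_le_h_c\<close>. All the limits exist by
  subadditivity (\<open>fekete\<close>).

  The inequality \<open>h_minus_le_h_plus\<close> is also simple: if a partition refines a cover, then
  its iterated joins refine those of the cover.

  The converse, \<open>h_plus_le_h_minus\<close>, requires a single partition that refines the cover and
  whose entropy rate is close to \<open>1 / n\<close> times the entropy of a partition \<open>\<beta>\<close> refining
  the \<open>n\<close>-fold join. A cell of \<open>\<beta>\<close> prescribes a sequence of \<open>n\<close> elements of the cover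
  for the next \<open>n\<close> steps of an orbit. If the space is cut into towers of height \<open>n\<close>, it is
  enough to look up \<open>\<beta>\<close> at the base \<open>C\<close> of the tower and to follow the prescribed
  sequence up to its top. The resulting partition is determined by the orbit of \<open>\<beta>\<close>
  restricted to \<open>C\<close>, apart from an exceptional set of small measure, so its entropy rate is
  about the contribution of \<open>C\<close> to the entropy of \<open>\<beta>\<close>. There are \<open>n\<close> phases in which
  the orbits can be cut, and they have disjoint bases. Since the contributions of disjoint
  sets add up to at most the entropy of \<open>\<beta>\<close> (\<open>sum_entropy_masked_le\<close>), some phase
  contributes at most \<open>1 / n\<close> of it.

  The towers come from a marker set that orbits meet rarely but regularly (\<open>marker_set\<close>,
  \<open>tower_phases\<close>). It exists only where the transformation has no short periods. On the
  points of short period some power of the transformation is the identity, and any partition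
  there has zero entropy rate.

  Throughout, partitions are handled as simple functions labelling their cells, because then
  joins are pairs, refinement is functional dependence, and subadditivity of entropy is that
  of random variables.
\<close>

section \<open>Subadditive sequences\<close>

text \<open>The limit is the infimum \<open>L\<close> of the quotients: if the quotient at \<open>k\<close> is close to \<open>L\<close>,
  then cutting \<open>n\<close> into blocks of length \<open>k\<close> bounds the quotient at \<open>n\<close>, up to the
  contribution of the remaining fewer than \<open>k\<close> terms, which is negligible after division by
  \<open>n\<close>.\<close>

lemma fekete:
  fixes a :: "nat \<Rightarrow> real"
  assumes sub: "\<And>m n. a (m + n) \<le> a m + a n" and nonneg: "\<And>n. 0 \<le> a n"
  shows "convergent (\<lambda>n. a n / real n)"
proof -
  define L where "L = (INF n\<in>{1..}. a n / real n)"
  have bdd: "bdd_below ((\<lambda>n. a n / real n) ` {1..})"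
    using nonneg by (intro bdd_belowI[of _ 0]) auto
  have lower: "L \<le> a n / real n" if "n \<ge> 1" for n
    unfolding L_def using that by (intro cINF_lower[OF bdd]) auto
  have mult: "a (q * k + r) \<le> real q * a k + a r" for q k r
  proof (induction q)
    case (Suc q)
    have "a (Suc q * k + r) \<le> a k + a (q * k + r)" using sub[of k "q * k + r"] by (simp add: ac_simps)
    with Suc show ?case by (simp add: algebra_simps)
  qed simp
  have "(\<lambda>n. a n / real n) \<longlonglongrightarrow> L"
  proof (rule LIMSEQ_I)
    fix e :: real assume e: "0 < e"
    then have "\<exists>k\<in>{1..}. a k / real k < L + e / 2"
      using cINF_less_iff[of "{1..}" "\<lambda>n. a n / real n" "L + e / 2"] bdd by (simp add: L_def)
    then obtain k :: nat where k: "k \<ge> 1" "a k / real k < L + e / 2" by auto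
    define C where "C = (\<Sum>r<k. a r)"
    have C: "a r \<le> C" if "r < k" for r
      unfolding C_def using that nonneg by (intro member_le_sum) auto
    obtain n0 :: nat where n0: "real n0 > 2 * C / e" using reals_Archimedean2 by blast
    have "norm (a n / real n - L) < e" if n: "n \<ge> max 1 n0" for n
    proof -
      have "a n \<le> real (n div k) * a k + a (n mod k)"
        using mult[of "n div k" k "n mod k"] by simp
      also have "\<dots> \<le> (real n / real k) * a k + C"
      proof (intro add_mono mult_right_mono)
        have "real (n div k) * real k \<le> real n" by (simp flip: of_nat_mult)
        then show "real (n div k) \<le> real n / real k" using k(1) by (simp add: field_simps)
      qed (use k nonneg C[of "n mod k"] in auto)
      finally have "a n / real n \<le> a k / real k + C / real n"
        using n k by (simp add: field_simps)
      moreover have "C / real n < e / 2"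
      proof -
        have "2 * C / e < real n" using n0 n by linarith
        then show ?thesis using e n by (simp add: field_simps)
      qed
      ultimately have "a n / real n < L + e" using k(2) by linarith
      then show ?thesis using lower[of n] n e by simp
    qed
    then show "\<exists>no. \<forall>n\<ge>no. norm (a n / real n - L) < e" by blast
  qed
  then show ?thesis by (rule convergentI)
qed

section \<open>Partitions as fibres of simple functions\<close>

definition fibres :: "'a measure \<Rightarrow> ('a \<Rightarrow> 'c) \<Rightarrow> 'a set set" where
  "fibres M F = (\<lambda>x. {y \<in> space M. F y = F x}) ` space M"

lemma fibres_alt: "fibres M F = (\<lambda>c. F -` {c} \<inter> space M) ` (F ` space M)"
  unfolding fibres_def image_image by (intro image_cong) auto

text \<open>A partition enters the argument only through the map sending a point to its cell. Any map
  with the right fibres will do in its place. The empty set, which a partition may contain,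
  is no fibre and has to be taken out.\<close>

definition labels :: "'a measure \<Rightarrow> ('a \<Rightarrow> 'c) \<Rightarrow> 'a set set \<Rightarrow> bool" where
  "labels M F \<alpha> \<longleftrightarrow> simple_function M F \<and> fibres M F = \<alpha> - {{}}"

lemma determined_factor:
  assumes "\<And>x y. x \<in> A \<Longrightarrow> y \<in> A \<Longrightarrow> G x = G y \<Longrightarrow> F x = F y"
  obtains f where "\<And>x. x \<in> A \<Longrightarrow> F x = (f \<circ> G) x"
proof
  fix x assume x: "x \<in> A"
  then have "\<exists>y. y \<in> A \<and> G y = G x" by blast
  from someI_ex[OF this] have "F x = F (SOME y. y \<in> A \<and> G y = G x)"
    using assms[OF x] by simp
  then show "F x = ((\<lambda>c. F (SOME y. y \<in> A \<and> G y = c)) \<circ> G) x" by simp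
qed

text \<open>Refinement of partitions becomes the statement that one function is determined by another.
  In this form there is no need to name the map through which \<open>F\<close> factors.\<close>

lemma simple_function_determined:
  assumes G: "simple_function M G"
    and det: "\<And>x y. x \<in> space M \<Longrightarrow> y \<in> space M \<Longrightarrow> G x = G y \<Longrightarrow> F x = F y"
  shows "simple_function M F"
proof -
  obtain f where f: "\<And>x. x \<in> space M \<Longrightarrow> F x = (f \<circ> G) x"
    using determined_factor[of "space M" G F] det by blast
  have "simple_function M (f \<circ> G)"
    using G by (rule simple_function_compose)
  then show ?thesis
    using simple_function_cong[of M F "f \<circ> G"] f by blast
qed

section \<open>Entropy of simple functions\<close>

context information_space
begin

lemma entropy_eq_sum:
  assumes X: "simple_function M X"
  shows "\<H>(X) = - (\<Sum>c\<in>X ` space M. prob (X -` {c} \<inter> space M) * log b (prob (X -` {c} \<inter> space M)))"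
  by (rule entropy_simple_distributed[OF simple_distributedI[OF X measure_nonneg refl]])

text \<open>Values that are not attained have empty fibres and contribute \<open>0 * log b 0 = 0\<close>.\<close>

lemma entropy_eq_sum_superset:
  assumes X: "simple_function M X" and S: "finite S" "X ` space M \<subseteq> S"
  shows "\<H>(X) = - (\<Sum>c\<in>S. prob (X -` {c} \<inter> space M) * log b (prob (X -` {c} \<inter> space M)))"
proof -
  have "X -` {c} \<inter> space M = {}" if "c \<in> S - X ` space M" for c
    using that by auto
  then show ?thesis
    unfolding entropy_eq_sum[OF X] using S by (subst sum.mono_neutral_left[OF S]) auto
qed

lemma entropy_nonneg_simple:
  assumes X: "simple_function M X" shows "0 \<le> \<H>(X)"
proof -
  have "p * log b p \<le> 0" if "0 \<le> p" "p \<le> 1" for p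
    using that b_gt_1 by (cases "p = 0") (auto intro!: mult_nonneg_nonpos)
  then show ?thesis
    unfolding entropy_eq_sum[OF X] by (auto intro!: sum_nonpos)
qed

lemma entropy_cong:
  assumes X: "simple_function M X" and eq: "\<And>x. x \<in> space M \<Longrightarrow> X x = Y x"
  shows "\<H>(X) = \<H>(Y)"
proof -
  have Y: "simple_function M Y" using X eq simple_function_cong by blast
  have im: "X ` space M = Y ` space M" using eq by (rule image_cong[OF refl])
  have "X -` {c} \<inter> space M = Y -` {c} \<inter> space M" for c using eq by auto
  then show ?thesis using entropy_eq_sum[OF X] entropy_eq_sum[OF Y] by (simp add: im)
qed

lemma entropy_determined:
  assumes G: "simple_function M G"
    and det: "\<And>x y. x \<in> space M \<Longrightarrow> y \<in> space M \<Longrightarrow> G x = G y \<Longrightarrow> F x = F y"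
  shows "\<H>(F) \<le> \<H>(G)"
proof -
  obtain f where f: "\<And>x. x \<in> space M \<Longrightarrow> F x = (f \<circ> G) x"
    using determined_factor[of "space M" G F] det by blast
  then have "\<H>(F) = \<H>(f \<circ> G)"
    by (intro entropy_cong simple_function_determined[OF G det])
  also have "\<dots> \<le> \<H>(G)" by (rule entropy_data_processing[OF G])
  finally show ?thesis .
qed

lemma entropy_pair_le:
  assumes "simple_function M F" "simple_function M G"
  shows "\<H>(\<lambda>x. (F x, G x)) \<le> \<H>(F) + \<H>(G)"
  using entropy_chain_rule[OF assms] conditional_entropy_less_eq_entropy[OF assms(2,1)] by linarith

lemma partition_entropy_labels:
  assumes "labels M F \<alpha>" shows "partition_entropy b M \<alpha> = \<H>(F)"
proof -
  have F: "simple_function M F" and fib: "fibres M F = \<alpha> - {{}}"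
    using assms by (auto simp: labels_def)
  have inj: "inj_on (\<lambda>c. F -` {c} \<inter> space M) (F ` space M)"
    by (auto simp: inj_on_def)
  have fin: "finite \<alpha>"
    using finite_imageI[OF simple_functionD(1)[OF F], of "\<lambda>c. F -` {c} \<inter> space M"] fib
    unfolding fibres_alt by simp
  have "partition_entropy b M \<alpha> = - (\<Sum>A\<in>\<alpha> - {{}}. prob A * log b (prob A))"
    unfolding partition_entropy_def using fin by (subst sum.mono_neutral_right[of \<alpha> "\<alpha> - {{}}"]) auto
  also have "\<dots> = \<H>(F)"
    unfolding fib[symmetric] fibres_alt entropy_eq_sum[OF F] sum.reindex[OF inj] by simp
  finally show ?thesis .
qed

end

lemma labels_fibres: "simple_function M F \<Longrightarrow> labels M F (fibres M F)"
  by (auto simp: labels_def fibres_def)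

lemma is_partition_labels:
  assumes "labels M F \<alpha>" shows "is_partition M \<alpha>"
proof -
  have F: "simple_function M F" and fib: "fibres M F = \<alpha> - {{}}"
    using assms by (auto simp: labels_def)
  have fin: "finite \<alpha>"
    using finite_imageI[OF simple_functionD(1)[OF F], of "\<lambda>c. F -` {c} \<inter> space M"] fib
    unfolding fibres_alt by simp
  have "\<Union>\<alpha> = \<Union>(fibres M F)" using fib by blast
  also have "\<dots> = space M" by (auto simp: fibres_def)
  finally have 1: "\<Union>\<alpha> = space M" .
  have "fibres M F \<subseteq> sets M" unfolding fibres_alt using simple_functionD(2)[OF F] by auto
  then have 2: "\<alpha> \<subseteq> sets M" using fib by blast
  have "disjoint (fibres M F)" by (auto simp: fibres_def disjoint_def)
  then have "disjoint \<alpha>" unfolding fib disjoint_def by blast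
  with fin 1 2 show ?thesis by (simp add: is_partition_def is_cover_def)
qed

lemma partition_has_labels:
  assumes "is_partition M \<alpha>" obtains F :: "'a \<Rightarrow> 'a set" where "labels M F \<alpha>"
proof -
  have a: "finite \<alpha>" "\<alpha> \<subseteq> sets M" "\<Union>\<alpha> = space M" "disjoint \<alpha>"
    using assms by (auto simp: is_partition_def is_cover_def)
  define F where "F x = (THE A. A \<in> \<alpha> \<and> x \<in> A)" for x
  have uniq: "F x = A" if "A \<in> \<alpha>" "x \<in> A" for x A
    unfolding F_def using that a(4) by (intro the_equality) (auto simp: disjoint_def)
  have Fx: "F x \<in> \<alpha> \<and> x \<in> F x" if "x \<in> space M" for x
    using that uniq a(3) by blast
  have im: "F ` space M \<subseteq> \<alpha>" using Fx by auto
  have cell: "F -` {A} \<inter> space M = A" if A: "A \<in> \<alpha>" for A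
  proof
    show "F -` {A} \<inter> space M \<subseteq> A" using Fx by auto
    show "A \<subseteq> F -` {A} \<inter> space M" using uniq[OF A] A a(3) by auto
  qed
  have "simple_function M F"
    unfolding simple_function_def
  proof
    show "finite (F ` space M)" using im a(1) by (rule finite_subset)
    show "\<forall>A\<in>F ` space M. F -` {A} \<inter> space M \<in> sets M"
      using im a(2) cell by (metis subsetD)
  qed
  moreover have "fibres M F = \<alpha> - {{}}"
  proof -
    have "F ` space M = \<alpha> - {{}}"
    proof
      show "F ` space M \<subseteq> \<alpha> - {{}}" using Fx by blast
      show "\<alpha> - {{}} \<subseteq> F ` space M"
      proof
        fix A assume A: "A \<in> \<alpha> - {{}}"
        then obtain x where "x \<in> A" by blast
        with A uniq[of A x] a(3) show "A \<in> F ` space M" by blast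
      qed
    qed
    moreover have "(\<lambda>c. F -` {c} \<inter> space M) ` (\<alpha> - {{}}) = id ` (\<alpha> - {{}})"
      using cell by (intro image_cong) auto
    ultimately show ?thesis unfolding fibres_alt by simp
  qed
  ultimately show ?thesis using that by (auto simp: labels_def)
qed

text \<open>Only the equivalence relation ``same value'' matters, so values may be renamed freely.\<close>

lemma labels_kernel:
  assumes "labels M F \<alpha>"
    and ker: "\<And>x y. x \<in> space M \<Longrightarrow> y \<in> space M \<Longrightarrow> F x = F y \<longleftrightarrow> G x = G y"
  shows "labels M G \<alpha>"
proof -
  have "fibres M G = fibres M F"
    unfolding fibres_def using ker by (intro image_cong) auto
  then show ?thesis
    using assms simple_function_determined[of M F G] by (auto simp: labels_def)
qed

lemma labels_join:
  assumes "labels M F \<alpha>" "labels M G \<beta>"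
  shows "labels M (\<lambda>x. (F x, G x)) (cover_join \<alpha> \<beta>)"
proof -
  have s: "simple_function M (\<lambda>x. (F x, G x))"
    using assms by (auto simp: labels_def intro: simple_function_Pair)
  have F: "fibres M F = \<alpha> - {{}}" and G: "fibres M G = \<beta> - {{}}"
    using assms by (auto simp: labels_def)
  have "cover_join \<alpha> \<beta> - {{}} = {A \<inter> B | A B. A \<in> fibres M F \<and> B \<in> fibres M G} - {{}}"
    unfolding F G cover_join_def by blast
  also have "\<dots> = fibres M (\<lambda>x. (F x, G x))"
  proof (intro equalityI subsetI)
    fix C assume "C \<in> {A \<inter> B | A B. A \<in> fibres M F \<and> B \<in> fibres M G} - {{}}"
    then obtain x y z where "C = {u\<in>space M. F u = F x} \<inter> {u\<in>space M. G u = G y}"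
      and z: "z \<in> C" by (auto simp: fibres_def)
    then have "C = {u\<in>space M. (F u, G u) = (F z, G z)}" "z \<in> space M" by auto
    then show "C \<in> fibres M (\<lambda>x. (F x, G x))" by (auto simp: fibres_def)
  next
    fix C assume "C \<in> fibres M (\<lambda>x. (F x, G x))"
    then obtain z where z: "z \<in> space M" "C = {u\<in>space M. (F u, G u) = (F z, G z)}"
      by (auto simp: fibres_def)
    then have "C = {u\<in>space M. F u = F z} \<inter> {u\<in>space M. G u = G z}" "z \<in> C" by auto
    with z(1) show "C \<in> {A \<inter> B | A B. A \<in> fibres M F \<and> B \<in> fibres M G} - {{}}"
      unfolding fibres_def by blast
  qed
  finally show ?thesis using s by (simp add: labels_def)
qed

lemma simple_function_comp_measurable:
  assumes "simple_function N F" "g \<in> measurable M N"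
  shows "simple_function M (\<lambda>x. F (g x))"
  unfolding simple_function_def
proof safe
  have "(\<lambda>x. F (g x)) ` space M \<subseteq> F ` space N"
    using measurable_space[OF assms(2)] by auto
  then show "finite ((\<lambda>x. F (g x)) ` space M)"
    using simple_functionD(1)[OF assms(1)] finite_subset by blast
next
  fix x
  have "(\<lambda>x. F (g x)) -` {c} \<inter> space M = g -` (F -` {c} \<inter> space N) \<inter> space M" for c
    using measurable_space[OF assms(2)] by auto
  then show "(\<lambda>x. F (g x)) -` {F (g x)} \<inter> space M \<in> sets M"
    using measurable_sets[OF assms(2) simple_functionD(2)[OF assms(1)]] by simp
qed

section \<open>Itineraries\<close>

lemma funpow_funpow: "(f ^^ m) ((f ^^ n) x) = (f ^^ (m + n)) x"
  by (simp add: funpow_add)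

definition itinerary :: "('a \<Rightarrow> 'a) \<Rightarrow> ('a \<Rightarrow> 'c) \<Rightarrow> nat \<Rightarrow> 'a \<Rightarrow> 'c list" where
  "itinerary T F n x = map (\<lambda>i. F ((T ^^ i) x)) [0..<n]"

lemma itinerary_eq_iff:
  "itinerary T F n x = itinerary T F n y \<longleftrightarrow> (\<forall>i<n. F ((T ^^ i) x) = F ((T ^^ i) y))"
  by (auto simp: itinerary_def list_eq_iff_nth_eq)

lemma simple_function_itinerary:
  assumes F: "simple_function M F" and g: "\<And>i. (g ^^ i) \<in> measurable M M"
  shows "simple_function M (itinerary g F n)"
proof (induction n)
  case 0
  show ?case by (simp add: itinerary_def[abs_def])
next
  case (Suc n)
  have "simple_function M (\<lambda>x. (itinerary g F n x, F ((g ^^ n) x)))"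
    by (intro simple_function_Pair Suc simple_function_comp_measurable[OF F g])
  then show ?case
    by (rule simple_function_determined) (auto simp: itinerary_eq_iff less_Suc_eq)
qed

context measure_dynamical_system
begin

lemma T_space: "x \<in> space M \<Longrightarrow> T x \<in> space M"
  using T_bij by (auto simp: bij_betw_def)

lemma iter_measurable: "(T ^^ n) \<in> measurable M M"
  by (rule measurable_compose_n[OF T_measurable])

lemma iter_space: "x \<in> space M \<Longrightarrow> (T ^^ n) x \<in> space M"
  using measurable_space[OF iter_measurable] by blast

lemma prob_vimage_T: "A \<in> sets M \<Longrightarrow> prob (T -` A \<inter> space M) = prob A"
  using T_preserving by (simp add: measure_def)

lemma prob_vimage_iter: "A \<in> sets M \<Longrightarrow> prob ((T ^^ n) -` A \<inter> space M) = prob A"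
proof (induction n)
  case 0
  then show ?case by (simp add: sets.sets_into_space Int_absorb2)
next
  case (Suc n)
  have "(T ^^ Suc n) -` A \<inter> space M = T -` ((T ^^ n) -` A \<inter> space M) \<inter> space M"
    using T_space by (auto simp: funpow_Suc_right simp del: funpow.simps)
  then show ?case
    using Suc.IH[OF Suc.prems] prob_vimage_T[OF measurable_sets[OF iter_measurable Suc.prems], of n]
    by (simp del: funpow.simps)
qed

lemma simple_iter: "simple_function M F \<Longrightarrow> simple_function M (\<lambda>x. F ((T ^^ n) x))"
  by (rule simple_function_comp_measurable[OF _ iter_measurable])

end

locale entropy_system = measure_dynamical_system M T + information_space M b
  for M :: "'a measure" and T :: "'a \<Rightarrow> 'a" and b :: real
begin

lemma entropy_iter:
  assumes F: "simple_function M F" shows "\<H>(\<lambda>x. F ((T ^^ n) x)) = \<H>(F)"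
proof -
  have sub: "(\<lambda>x. F ((T ^^ n) x)) ` space M \<subseteq> F ` space M"
    using iter_space by auto
  have "(\<lambda>x. F ((T ^^ n) x)) -` {c} \<inter> space M = (T ^^ n) -` (F -` {c} \<inter> space M) \<inter> space M" for c
    using iter_space by auto
  then have "prob ((\<lambda>x. F ((T ^^ n) x)) -` {c} \<inter> space M) = prob (F -` {c} \<inter> space M)" for c
    using prob_vimage_iter[OF simple_functionD(2)[OF F]] by simp
  then show ?thesis
    unfolding entropy_eq_sum[OF F]
      entropy_eq_sum_superset[OF simple_iter[OF F] simple_functionD(1)[OF F] sub] by simp
qed

lemma simple_itinerary: "simple_function M F \<Longrightarrow> simple_function M (itinerary T F n)"
  by (rule simple_function_itinerary[OF _ iter_measurable])

lemma labels_pullback: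
  assumes "labels M F \<alpha>" shows "labels M (\<lambda>x. F ((T ^^ n) x)) (pullback M T n \<alpha>)"
proof -
  have s: "simple_function M (\<lambda>x. F ((T ^^ n) x))"
    using assms by (auto simp: labels_def intro: simple_iter)
  have F: "fibres M F = \<alpha> - {{}}" using assms by (auto simp: labels_def)
  have "pullback M T n \<alpha> - {{}} = (\<lambda>U. (T ^^ n) -` U \<inter> space M) ` (fibres M F) - {{}}"
    unfolding F pullback_def by blast
  also have "\<dots> = fibres M (\<lambda>x. F ((T ^^ n) x))"
  proof (intro equalityI subsetI)
    fix C assume "C \<in> (\<lambda>U. (T ^^ n) -` U \<inter> space M) ` (fibres M F) - {{}}"
    then obtain x z where C: "C = (T ^^ n) -` {u\<in>space M. F u = F x} \<inter> space M" and z: "z \<in> C"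
      by (auto simp: fibres_def)
    then have "C = {u\<in>space M. F ((T ^^ n) u) = F ((T ^^ n) z)}" "z \<in> space M"
      using iter_space by auto
    then show "C \<in> fibres M (\<lambda>x. F ((T ^^ n) x))" by (auto simp: fibres_def)
  next
    fix C assume "C \<in> fibres M (\<lambda>x. F ((T ^^ n) x))"
    then obtain z where z: "z \<in> space M" "C = {u\<in>space M. F ((T ^^ n) u) = F ((T ^^ n) z)}"
      by (auto simp: fibres_def)
    then have "C = (T ^^ n) -` {u\<in>space M. F u = F ((T ^^ n) z)} \<inter> space M" "z \<in> C"
      using iter_space by auto
    with iter_space[OF z(1)] show "C \<in> (\<lambda>U. (T ^^ n) -` U \<inter> space M) ` (fibres M F) - {{}}"
      unfolding fibres_def by blast
  qed
  finally show ?thesis using s by (simp add: labels_def)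
qed

lemma labels_iter_join:
  assumes "labels M F \<alpha>" shows "labels M (itinerary T F n) (iter_join M T \<alpha> n)"
proof (induction n)
  case 0
  have "fibres M (itinerary T F 0) = {space M}"
    using not_empty by (auto simp: fibres_def itinerary_def)
  then show ?case using not_empty by (simp add: labels_def itinerary_def[abs_def])
next
  case (Suc n)
  show ?case
    unfolding iter_join.simps
    by (rule labels_kernel[OF labels_join[OF Suc labels_pullback[OF assms]]])
       (auto simp: itinerary_eq_iff less_Suc_eq)
qed

lemma partition_entropy_iter_join:
  "labels M F \<alpha> \<Longrightarrow> partition_entropy b M (iter_join M T \<alpha> n) = \<H>(itinerary T F n)"
  by (rule partition_entropy_labels[OF labels_iter_join])

lemma entropy_itinerary_add:
  assumes F: "simple_function M F"
  shows "\<H>(itinerary T F (m + n)) \<le> \<H>(itinerary T F m) + \<H>(itinerary T F n)"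
proof -
  note s = simple_itinerary[OF F]
  have "\<H>(itinerary T F (m + n)) \<le> \<H>(\<lambda>x. (itinerary T F m x, itinerary T F n ((T ^^ m) x)))"
  proof (rule entropy_determined)
    show "simple_function M (\<lambda>x. (itinerary T F m x, itinerary T F n ((T ^^ m) x)))"
      by (intro simple_function_Pair s simple_iter)
    fix x y assume "(itinerary T F m x, itinerary T F n ((T ^^ m) x)) = (itinerary T F m y, itinerary T F n ((T ^^ m) y))"
    then have 1: "\<And>i. i < m \<Longrightarrow> F ((T ^^ i) x) = F ((T ^^ i) y)"
      and 2: "\<And>i. i < n \<Longrightarrow> F ((T ^^ (i + m)) x) = F ((T ^^ (i + m)) y)"
      by (auto simp: itinerary_eq_iff funpow_add)
    show "itinerary T F (m + n) x = itinerary T F (m + n) y"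
      unfolding itinerary_eq_iff
    proof safe
      fix i assume "i < m + n"
      then show "F ((T ^^ i) x) = F ((T ^^ i) y)"
        using 1[of i] 2[of "i - m"] by (cases "i < m") auto
    qed
  qed
  also have "\<dots> \<le> \<H>(itinerary T F m) + \<H>(\<lambda>x. itinerary T F n ((T ^^ m) x))"
    by (intro entropy_pair_le s simple_iter)
  also have "\<H>(\<lambda>x. itinerary T F n ((T ^^ m) x)) = \<H>(itinerary T F n)"
    by (rule entropy_iter[OF s])
  finally show ?thesis by simp
qed

end

section \<open>Entropy and covering number of covers\<close>

text \<open>A partition finer than a cover amounts, up to merging cells, to a way of choosing, for each
  point, one element of the cover containing it. Choosing is more convenient than refining:
  choices can be made independently on different parts of the space.\<close>

definition selectors :: "'a measure \<Rightarrow> 'a set set \<Rightarrow> ('a \<Rightarrow> 'a set) set" where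
  "selectors M \<U> = {F. simple_function M F \<and> (\<forall>x\<in>space M. x \<in> F x \<and> F x \<in> \<U>)}"

text \<open>Added one at a time, each new set takes the points that it contains away from the earlier
  ones.\<close>

lemma selector_exists:
  assumes "finite \<W>" "\<W> \<subseteq> sets M" "\<Union>\<W> = space M"
  obtains F where "F \<in> selectors M \<W>"
proof -
  have "\<exists>F. simple_function M F \<and> (\<forall>x\<in>\<Union>\<W>. x \<in> F x \<and> F x \<in> \<W>)"
    using assms(1,2)
  proof (induction \<W>)
    case empty
    then show ?case by (intro exI[of _ "\<lambda>_. {}"]) auto
  next
    case (insert A \<W>)
    then obtain F where F: "simple_function M F" "\<forall>x\<in>\<Union>\<W>. x \<in> F x \<and> F x \<in> \<W>" by auto
    have "simple_function M (\<lambda>x. if x \<in> A then A else F x)"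
      using insert.prems F(1) by (intro simple_function_If_set) (auto simp: sets.Int_space_eq2)
    then show ?case using F(2) by (intro exI[of _ "\<lambda>x. if x \<in> A then A else F x"]) auto
  qed
  then show ?thesis using that assms(3) by (auto simp: selectors_def)
qed

lemma selector_partition:
  assumes "F \<in> selectors M \<U>"
  shows "is_partition M (fibres M F)" "finer (fibres M F) \<U>"
proof -
  show "is_partition M (fibres M F)"
    using assms is_partition_labels[OF labels_fibres, of M F] by (simp add: selectors_def)
  show "finer (fibres M F) \<U>"
    unfolding finer_def
  proof
    fix A assume "A \<in> fibres M F"
    then obtain x where x: "x \<in> space M" "A = {y \<in> space M. F y = F x}" by (auto simp: fibres_def)
    then have "A \<subseteq> F x" "F x \<in> \<U>" using assms by (auto simp: selectors_def)
    then show "\<exists>V\<in>\<U>. A \<subseteq> V" by blast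
  qed
qed

text \<open>Passing to a selector can merge cells that lie in the same element of the cover, so the
  selector is determined by the partition but need not label it.\<close>

lemma partition_selector:
  assumes G: "labels M G \<alpha>" and fin: "finer \<alpha> \<U>"
  obtains F where "F \<in> selectors M \<U>"
    "\<And>x y. x \<in> space M \<Longrightarrow> y \<in> space M \<Longrightarrow> G x = G y \<Longrightarrow> F x = F y"
proof -
  define F where "F x = (SOME V. V \<in> \<U> \<and> {y \<in> space M. G y = G x} \<subseteq> V)" for x
  have F: "F x \<in> \<U> \<and> {y \<in> space M. G y = G x} \<subseteq> F x" if "x \<in> space M" for x
  proof -
    have "{y \<in> space M. G y = G x} \<in> \<alpha>"
      using G that by (auto simp: labels_def fibres_def)
    then have "\<exists>V. V \<in> \<U> \<and> {y \<in> space M. G y = G x} \<subseteq> V"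
      using fin by (auto simp: finer_def)
    from someI_ex[OF this] show ?thesis unfolding F_def .
  qed
  have det: "F x = F y" if "G x = G y" for x y using that by (simp add: F_def)
  have "simple_function M F"
  proof (rule simple_function_determined)
    show "simple_function M G" using G by (simp add: labels_def)
  qed (rule det)
  then have "F \<in> selectors M \<U>" using F G by (fastforce simp: selectors_def labels_def)
  then show ?thesis using det by (rule that)
qed

context information_space
begin

lemma entropy_le_log_card_superset:
  assumes F: "simple_function M F" and S: "finite S" "F ` space M \<subseteq> S"
  shows "\<H>(F) \<le> log b (card S)"
proof -
  have "\<H>(F) \<le> log b (real (card (F ` space M)))"
    by (rule entropy_le_card[OF simple_distributedI[OF F measure_nonneg refl]])
  also have "\<dots> \<le> log b (card S)"
    using S not_empty b_gt_1 card_mono[OF S] card_gt_0_iff[of "F ` space M"] finite_subset[OF S(2,1)]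
    by (intro log_mono) auto
  finally show ?thesis .
qed

lemma partition_entropy_nonneg:
  assumes "is_partition M \<alpha>" shows "0 \<le> partition_entropy b M \<alpha>"
proof -
  obtain F :: "'a \<Rightarrow> 'a set" where F: "labels M F \<alpha>" using partition_has_labels[OF assms] .
  then show ?thesis
    using entropy_nonneg_simple[of F] by (simp add: partition_entropy_labels[OF F] labels_def)
qed

lemma cover_entropy_le_selector:
  assumes "F \<in> selectors M \<V>" shows "cover_entropy b M \<V> \<le> \<H>(F)"
proof -
  have "partition_entropy b M (fibres M F) = \<H>(F)"
    using assms by (intro partition_entropy_labels labels_fibres) (auto simp: selectors_def)
  then have "\<H>(F) \<in> {partition_entropy b M \<alpha> | \<alpha>. is_partition M \<alpha> \<and> finer \<alpha> \<V>}"
    using selector_partition[OF assms] by force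
  then show ?thesis
    unfolding cover_entropy_def using partition_entropy_nonneg
    by (intro cInf_lower bdd_belowI[of _ 0]) auto
qed

lemma selector_near_cover_entropy:
  assumes "is_cover M \<V>" and e: "0 < e"
  obtains F where "F \<in> selectors M \<V>" "\<H>(F) < cover_entropy b M \<V> + e"
proof -
  let ?S = "{partition_entropy b M \<alpha> | \<alpha>. is_partition M \<alpha> \<and> finer \<alpha> \<V>}"
  obtain F0 where "F0 \<in> selectors M \<V>"
    using assms selector_exists[of \<V> M] by (auto simp: is_cover_def)
  then have "?S \<noteq> {}" using selector_partition by blast
  then have "\<exists>s\<in>?S. s < cover_entropy b M \<V> + e"
    using e cInf_lessD[of ?S "cover_entropy b M \<V> + e"] by (auto simp: cover_entropy_def)
  then obtain \<alpha> where \<alpha>: "is_partition M \<alpha>" "finer \<alpha> \<V>"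
    "partition_entropy b M \<alpha> < cover_entropy b M \<V> + e" by auto
  obtain G :: "'a \<Rightarrow> 'a set" where G: "labels M G \<alpha>" using partition_has_labels[OF \<alpha>(1)] .
  obtain F where F: "F \<in> selectors M \<V>"
    "\<And>x y. x \<in> space M \<Longrightarrow> y \<in> space M \<Longrightarrow> G x = G y \<Longrightarrow> F x = F y"
    using partition_selector[OF G \<alpha>(2)] by blast
  have "\<H>(F) \<le> \<H>(G)"
  proof (rule entropy_determined)
    show "simple_function M G" using G by (simp add: labels_def)
  qed (rule F(2))
  then show ?thesis using that[OF F(1)] \<alpha>(3) partition_entropy_labels[OF G] by simp
qed

lemma cover_entropy_nonneg:
  assumes "is_cover M \<V>" shows "0 \<le> cover_entropy b M \<V>"
proof -
  obtain F0 where "F0 \<in> selectors M \<V>"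
    using assms selector_exists[of \<V> M] by (auto simp: is_cover_def)
  then have "{partition_entropy b M \<alpha> | \<alpha>. is_partition M \<alpha> \<and> finer \<alpha> \<V>} \<noteq> {}"
    using selector_partition by blast
  then show ?thesis
    unfolding cover_entropy_def using partition_entropy_nonneg by (intro cInf_greatest) auto
qed

end

lemma cover_number_le:
  assumes "finite \<V>" "\<W> \<subseteq> \<V>" "\<Union>\<W> = space M"
  shows "cover_number M \<V> \<le> card \<W>"
proof -
  have "{card \<W> | \<W>. \<W> \<subseteq> \<V> \<and> \<Union>\<W> = space M} \<subseteq> card ` Pow \<V>" by auto
  then have "finite {card \<W> | \<W>. \<W> \<subseteq> \<V> \<and> \<Union>\<W> = space M}"
    using assms(1) finite_subset by blast
  then show ?thesis unfolding cover_number_def using assms by (intro Min_le) auto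
qed

lemma minimal_subcover:
  assumes "is_cover M \<V>"
  obtains \<W> where "\<W> \<subseteq> \<V>" "\<Union>\<W> = space M" "card \<W> = cover_number M \<V>"
proof -
  let ?S = "{card \<W> | \<W>. \<W> \<subseteq> \<V> \<and> \<Union>\<W> = space M}"
  have "?S \<subseteq> card ` Pow \<V>" by auto
  then have "finite ?S" using assms finite_subset[of ?S "card ` Pow \<V>"] by (simp add: is_cover_def)
  moreover have "?S \<noteq> {}" using assms by (auto simp: is_cover_def)
  ultimately have "cover_number M \<V> \<in> ?S" unfolding cover_number_def by (rule Min_in)
  then show ?thesis using that by auto
qed

context entropy_system
begin

lemma cover_number_pos:
  assumes "is_cover M \<V>" shows "0 < cover_number M \<V>"
proof -
  obtain \<W> where \<W>: "\<W> \<subseteq> \<V>" "\<Union>\<W> = space M" "card \<W> = cover_number M \<V>"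
    using minimal_subcover[OF assms] .
  then have "finite \<W>" "\<W> \<noteq> {}"
    using assms finite_subset[OF \<W>(1)] not_empty by (auto simp: is_cover_def)
  then show ?thesis using \<W>(3) card_gt_0_iff[of \<W>] by simp
qed

text \<open>The index sequence \<open>u\<close> is kept because an element of the iterated join, as a set, does not
  tell which elements of the cover were intersected.\<close>

lemma iter_join_iff:
  "V \<in> iter_join M T \<U> n \<longleftrightarrow>
    (\<exists>u. (\<forall>i<n. u i \<in> \<U>) \<and> V = {x \<in> space M. \<forall>i<n. (T ^^ i) x \<in> u i})"
proof (induction n arbitrary: V)
  case 0
  then show ?case by auto
next
  case (Suc n)
  show ?case
  proof
    assume "V \<in> iter_join M T \<U> (Suc n)"
    then obtain W U where W: "W \<in> iter_join M T \<U> n" and U: "U \<in> \<U>"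
      and V: "V = W \<inter> ((T ^^ n) -` U \<inter> space M)"
      by (auto simp: cover_join_def pullback_def)
    obtain u where u: "\<forall>i<n. u i \<in> \<U>" "W = {x \<in> space M. \<forall>i<n. (T ^^ i) x \<in> u i}"
      using W Suc by blast
    have "(\<forall>i<Suc n. (u(n := U)) i \<in> \<U>) \<and> V = {x \<in> space M. \<forall>i<Suc n. (T ^^ i) x \<in> (u(n := U)) i}"
      using u U unfolding V by (auto simp: less_Suc_eq)
    then show "\<exists>u. (\<forall>i<Suc n. u i \<in> \<U>) \<and> V = {x \<in> space M. \<forall>i<Suc n. (T ^^ i) x \<in> u i}" by blast
  next
    assume "\<exists>u. (\<forall>i<Suc n. u i \<in> \<U>) \<and> V = {x \<in> space M. \<forall>i<Suc n. (T ^^ i) x \<in> u i}"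
    then obtain u where u: "\<forall>i<Suc n. u i \<in> \<U>" "V = {x \<in> space M. \<forall>i<Suc n. (T ^^ i) x \<in> u i}" by blast
    have "{x \<in> space M. \<forall>i<n. (T ^^ i) x \<in> u i} \<in> iter_join M T \<U> n"
      unfolding Suc using u(1) by (intro exI[of _ u]) auto
    moreover have "(T ^^ n) -` u n \<inter> space M \<in> pullback M T n \<U>"
      using u(1) by (auto simp: pullback_def)
    moreover have "V = {x \<in> space M. \<forall>i<n. (T ^^ i) x \<in> u i} \<inter> ((T ^^ n) -` u n \<inter> space M)"
      unfolding u(2) by (auto simp: less_Suc_eq)
    ultimately show "V \<in> iter_join M T \<U> (Suc n)"
      unfolding iter_join.simps cover_join_def by blast
  qed
qed

lemma iter_join_combine:
  assumes A: "A \<in> iter_join M T \<U> m" and B: "B \<in> iter_join M T \<U> n"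
  shows "A \<inter> ((T ^^ m) -` B \<inter> space M) \<in> iter_join M T \<U> (m + n)"
proof -
  obtain u v where u: "\<forall>i<m. u i \<in> \<U>" "A = {x \<in> space M. \<forall>i<m. (T ^^ i) x \<in> u i}"
    and v: "\<forall>i<n. v i \<in> \<U>" "B = {x \<in> space M. \<forall>i<n. (T ^^ i) x \<in> v i}"
    using A B unfolding iter_join_iff by blast
  define w where "w i = (if i < m then u i else v (i - m))" for i
  have "\<forall>i<m+n. w i \<in> \<U>" using u(1) v(1) by (auto simp: w_def)
  moreover have "A \<inter> ((T ^^ m) -` B \<inter> space M) = {x \<in> space M. \<forall>i<m+n. (T ^^ i) x \<in> w i}"
  proof (intro equalityI subsetI)
    fix x assume "x \<in> A \<inter> ((T ^^ m) -` B \<inter> space M)"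
    then have x: "x \<in> space M" "\<And>i. i < m \<Longrightarrow> (T ^^ i) x \<in> u i"
      "\<And>i. i < n \<Longrightarrow> (T ^^ i) ((T ^^ m) x) \<in> v i" by (auto simp: u v)
    have "(T ^^ i) x \<in> w i" if "i < m + n" for i
    proof (cases "i < m")
      case False
      then show ?thesis using x(3)[of "i - m"] that funpow_add[of "i - m" m T]
        by (simp add: w_def)
    qed (use x in \<open>simp add: w_def\<close>)
    then show "x \<in> {x \<in> space M. \<forall>i<m+n. (T ^^ i) x \<in> w i}" using x by simp
  next
    fix x assume "x \<in> {x \<in> space M. \<forall>i<m+n. (T ^^ i) x \<in> w i}"
    then have x: "x \<in> space M" "\<And>i. i < m + n \<Longrightarrow> (T ^^ i) x \<in> w i" by auto
    have "(T ^^ i) ((T ^^ m) x) \<in> v i" if "i < n" for i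
      using x(2)[of "i + m"] that by (simp add: w_def funpow_add)
    moreover have "(T ^^ i) x \<in> u i" if "i < m" for i
      using x(2)[of i] that by (simp add: w_def)
    ultimately show "x \<in> A \<inter> ((T ^^ m) -` B \<inter> space M)"
      using x(1) iter_space by (auto simp: u v)
  qed
  ultimately show ?thesis unfolding iter_join_iff by blast
qed

lemma is_cover_iter_join:
  assumes "is_cover M \<U>" shows "is_cover M (iter_join M T \<U> n)"
proof (induction n)
  case 0
  then show ?case by (simp add: is_cover_def)
next
  case (Suc n)
  have fin: "finite (cover_join A B)" if "finite A" "finite B" for A B :: "'a set set"
  proof -
    have "cover_join A B = (\<lambda>(U, V). U \<inter> V) ` (A \<times> B)" by (auto simp: cover_join_def)
    then show ?thesis using that by simp
  qed
  have pb: "pullback M T n \<U> \<subseteq> sets M" "finite (pullback M T n \<U>)"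
    using assms measurable_sets[OF iter_measurable] by (auto simp: pullback_def is_cover_def)
  have un: "\<Union>(pullback M T n \<U>) = space M"
    using assms iter_space by (fastforce simp: pullback_def is_cover_def)
  have "\<Union>(cover_join A B) = \<Union>A \<inter> \<Union>B" for A B :: "'a set set"
    by (auto simp: cover_join_def)
  then show ?case
    using Suc fin pb un by (auto simp: is_cover_def cover_join_def)
qed

text \<open>Selecting for the first \<open>m\<close> and, after moving along by \<open>m\<close> steps, for the next \<open>n\<close> steps
  gives a selector for all \<open>m + n\<close> steps. The second one has the entropy it had before
  moving, as the transformation preserves the measure.\<close>

lemma cover_entropy_iter_join_add:
  assumes "is_cover M \<U>"
  shows "cover_entropy b M (iter_join M T \<U> (m + n))
    \<le> cover_entropy b M (iter_join M T \<U> m) + cover_entropy b M (iter_join M T \<U> n)"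
proof (rule field_le_epsilon)
  fix e :: real assume "0 < e"
  then have e: "0 < e / 2" by simp
  obtain F where F: "F \<in> selectors M (iter_join M T \<U> m)"
    "\<H>(F) < cover_entropy b M (iter_join M T \<U> m) + e / 2"
    using selector_near_cover_entropy[OF is_cover_iter_join[OF assms] e] .
  obtain G where G: "G \<in> selectors M (iter_join M T \<U> n)"
    "\<H>(G) < cover_entropy b M (iter_join M T \<U> n) + e / 2"
    using selector_near_cover_entropy[OF is_cover_iter_join[OF assms] e] .
  have s: "simple_function M F" "simple_function M G" using F G by (auto simp: selectors_def)
  define K where "K x = F x \<inter> ((T ^^ m) -` G ((T ^^ m) x) \<inter> space M)" for x
  have sP: "simple_function M (\<lambda>x. (F x, G ((T ^^ m) x)))"
    by (intro simple_function_Pair s simple_iter)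
  have "simple_function M K"
    by (rule simple_function_determined[OF sP]) (auto simp: K_def)
  then have "K \<in> selectors M (iter_join M T \<U> (m + n))"
    using F(1) G(1) iter_space iter_join_combine[of _ \<U> m _ n] by (auto simp: selectors_def K_def)
  then have "cover_entropy b M (iter_join M T \<U> (m + n)) \<le> \<H>(K)"
    by (rule cover_entropy_le_selector)
  also have "\<dots> \<le> \<H>(\<lambda>x. (F x, G ((T ^^ m) x)))"
    by (rule entropy_determined[OF sP]) (auto simp: K_def)
  also have "\<dots> \<le> \<H>(F) + \<H>(\<lambda>x. G ((T ^^ m) x))"
    by (intro entropy_pair_le s simple_iter)
  also have "\<dots> = \<H>(F) + \<H>(G)" by (simp add: entropy_iter[OF s(2)])
  finally show "cover_entropy b M (iter_join M T \<U> (m + n))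
    \<le> cover_entropy b M (iter_join M T \<U> m) + cover_entropy b M (iter_join M T \<U> n) + e"
    using F(2) G(2) by linarith
qed

lemma h_minus_limit:
  assumes "is_cover M \<U>"
  shows "(\<lambda>n. cover_entropy b M (iter_join M T \<U> n) / real n) \<longlonglongrightarrow> h_minus b M T \<U>"
  unfolding h_minus_def convergent_LIMSEQ_iff[symmetric]
  by (rule fekete[OF cover_entropy_iter_join_add[OF assms]
        cover_entropy_nonneg[OF is_cover_iter_join[OF assms]]])

lemma dyn_entropy_limit:
  assumes "labels M F \<alpha>"
  shows "(\<lambda>n. \<H>(itinerary T F n) / real n) \<longlonglongrightarrow> dyn_entropy b M T \<alpha>"
  unfolding dyn_entropy_def partition_entropy_iter_join[OF assms] convergent_LIMSEQ_iff[symmetric]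
proof (rule fekete)
  have F: "simple_function M F" using assms by (simp add: labels_def)
  fix m n
  show "\<H>(itinerary T F (m + n)) \<le> \<H>(itinerary T F m) + \<H>(itinerary T F n)"
    by (rule entropy_itinerary_add[OF F])
  show "0 \<le> \<H>(itinerary T F n)" by (rule entropy_nonneg_simple[OF simple_itinerary[OF F]])
qed

lemma cover_number_iter_join_add:
  assumes "is_cover M \<U>"
  shows "cover_number M (iter_join M T \<U> (m + n))
    \<le> cover_number M (iter_join M T \<U> m) * cover_number M (iter_join M T \<U> n)"
proof -
  note c = is_cover_iter_join[OF assms]
  obtain \<V> where \<V>: "\<V> \<subseteq> iter_join M T \<U> m" "\<Union>\<V> = space M"
    "card \<V> = cover_number M (iter_join M T \<U> m)" using minimal_subcover[OF c] .
  obtain \<W> where \<W>: "\<W> \<subseteq> iter_join M T \<U> n" "\<Union>\<W> = space M"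
    "card \<W> = cover_number M (iter_join M T \<U> n)" using minimal_subcover[OF c] .
  have fin: "finite \<V>" "finite \<W>" using \<V>(1) \<W>(1) c finite_subset unfolding is_cover_def by blast+
  let ?f = "\<lambda>(A, B). A \<inter> ((T ^^ m) -` B \<inter> space M)"
  have "cover_number M (iter_join M T \<U> (m + n)) \<le> card (?f ` (\<V> \<times> \<W>))"
  proof (rule cover_number_le)
    show "finite (iter_join M T \<U> (m + n))" using c by (simp add: is_cover_def)
    show "?f ` (\<V> \<times> \<W>) \<subseteq> iter_join M T \<U> (m + n)"
      using \<V>(1) \<W>(1) by (auto intro!: iter_join_combine)
    show "\<Union>(?f ` (\<V> \<times> \<W>)) = space M"
    proof (intro equalityI subsetI)
      fix x assume x: "x \<in> space M"
      then obtain A B where "A \<in> \<V>" "x \<in> A" "B \<in> \<W>" "(T ^^ m) x \<in> B"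
        using \<V>(2) \<W>(2) iter_space[OF x, of m] by blast
      then show "x \<in> \<Union>(?f ` (\<V> \<times> \<W>))" using x by force
    qed auto
  qed
  also have "\<dots> \<le> card (\<V> \<times> \<W>)" using fin by (intro card_image_le) auto
  also have "\<dots> = cover_number M (iter_join M T \<U> m) * cover_number M (iter_join M T \<U> n)"
    using \<V>(3) \<W>(3) by (simp add: card_cartesian_product)
  finally show ?thesis .
qed

lemma h_c_limit:
  assumes "is_cover M \<U>"
  shows "(\<lambda>n. log b (real (cover_number M (iter_join M T \<U> n))) / real n) \<longlonglongrightarrow> h_c b M T \<U>"
  unfolding h_c_def convergent_LIMSEQ_iff[symmetric]
proof (rule fekete)
  let ?N = "\<lambda>n. cover_number M (iter_join M T \<U> n)"
  have pos: "0 < ?N n" for n by (intro cover_number_pos is_cover_iter_join assms)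
  fix m n
  have "log b (real (?N (m + n))) \<le> log b (real (?N m) * real (?N n))"
    using pos b_gt_1 cover_number_iter_join_add[OF assms, of m n]
    by (intro log_mono) (auto simp flip: of_nat_mult)
  also have "\<dots> = log b (real (?N m)) + log b (real (?N n))"
    using pos by (simp add: log_mult_pos)
  finally show "log b (real (?N (m + n))) \<le> log b (real (?N m)) + log b (real (?N n))" .
  show "0 \<le> log b (real (?N n))"
    using pos[of n] b_gt_1 by simp
qed

text \<open>A minimal subcover has a selector taking at most as many values as it has elements, and
  the entropy of a function is at most the logarithm of the number of its values.\<close>

lemma cover_entropy_le_log_cover_number:
  assumes "is_cover M \<V>" shows "cover_entropy b M \<V> \<le> log b (real (cover_number M \<V>))"
proof -
  obtain \<W> where \<W>: "\<W> \<subseteq> \<V>" "\<Union>\<W> = space M" "card \<W> = cover_number M \<V>"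
    using minimal_subcover[OF assms] .
  have fin: "finite \<W>" "\<W> \<subseteq> sets M" using assms \<W>(1) finite_subset[OF \<W>(1)] by (auto simp: is_cover_def)
  obtain F where F: "F \<in> selectors M \<W>" using selector_exists[OF fin \<W>(2)] .
  then have "F \<in> selectors M \<V>" using \<W>(1) by (auto simp: selectors_def)
  then have "cover_entropy b M \<V> \<le> \<H>(F)" by (rule cover_entropy_le_selector)
  also have "\<dots> \<le> log b (card \<W>)"
    using F fin by (intro entropy_le_log_card_superset) (auto simp: selectors_def)
  finally show ?thesis using \<W>(3) by simp
qed

lemma h_minus_le_h_c:
  assumes "is_cover M \<U>" shows "h_minus b M T \<U> \<le> h_c b M T \<U>"
  by (rule LIMSEQ_le[OF h_minus_limit[OF assms] h_c_limit[OF assms]])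
     (auto intro!: divide_right_mono cover_entropy_le_log_cover_number is_cover_iter_join assms)

text \<open>If each point \<open>x\<close> has a chosen set \<open>F x\<close>, then the points whose first \<open>n\<close> iterates lie in
  the sets chosen along the orbit of \<open>x\<close> form an element of the iterated join that contains
  \<open>x\<close>, and it depends only on the itinerary of \<open>x\<close>.\<close>

lemma h_minus_le_dyn_entropy:
  assumes U: "is_cover M \<U>" and p: "is_partition M \<alpha>" and fin: "finer \<alpha> \<U>"
  shows "h_minus b M T \<U> \<le> dyn_entropy b M T \<alpha>"
proof -
  obtain G :: "'a \<Rightarrow> 'a set" where G: "labels M G \<alpha>" using partition_has_labels[OF p] .
  then have sG: "simple_function M G" by (simp add: labels_def)
  obtain F where F: "F \<in> selectors M \<U>"
    and det: "\<And>x y. x \<in> space M \<Longrightarrow> y \<in> space M \<Longrightarrow> G x = G y \<Longrightarrow> F x = F y"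
    using partition_selector[OF G fin] by blast
  have "cover_entropy b M (iter_join M T \<U> n) \<le> \<H>(itinerary T G n)" for n
  proof -
    define K where "K x = {y \<in> space M. \<forall>i<n. (T ^^ i) y \<in> F ((T ^^ i) x)}" for x
    have Kdet: "K x = K y"
      if "x \<in> space M" "y \<in> space M" "itinerary T G n x = itinerary T G n y" for x y
    proof -
      have "F ((T ^^ i) x) = F ((T ^^ i) y)" if "i < n" for i
        using that \<open>itinerary T G n x = itinerary T G n y\<close>
          det[OF iter_space[OF \<open>x \<in> space M\<close>] iter_space[OF \<open>y \<in> space M\<close>]]
        unfolding itinerary_eq_iff by blast
      then show ?thesis by (simp add: K_def)
    qed
    have "K x \<in> iter_join M T \<U> n \<and> x \<in> K x" if x: "x \<in> space M" for x
    proof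
      show "K x \<in> iter_join M T \<U> n"
        unfolding iter_join_iff K_def
        using F iter_space[OF x] by (intro exI[of _ "\<lambda>i. F ((T ^^ i) x)"]) (auto simp: selectors_def)
      show "x \<in> K x" using F x iter_space[OF x] by (auto simp: K_def selectors_def)
    qed
    then have "K \<in> selectors M (iter_join M T \<U> n)"
      using simple_function_determined[OF simple_itinerary[OF sG] Kdet] by (simp add: selectors_def)
    then have "cover_entropy b M (iter_join M T \<U> n) \<le> \<H>(K)"
      by (rule cover_entropy_le_selector)
    also have "\<dots> \<le> \<H>(itinerary T G n)"
      by (rule entropy_determined[OF simple_itinerary[OF sG] Kdet])
    finally show ?thesis .
  qed
  then show ?thesis
    by (intro LIMSEQ_le[OF h_minus_limit[OF U] dyn_entropy_limit[OF G]])
       (auto intro!: divide_right_mono)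
qed

lemma h_minus_le_h_plus:
  assumes U: "is_cover M \<U>" shows "h_minus b M T \<U> \<le> h_plus b M T \<U>"
proof -
  obtain F0 where "F0 \<in> selectors M \<U>"
    using U selector_exists[of \<U> M] by (auto simp: is_cover_def)
  then have "{dyn_entropy b M T \<alpha> | \<alpha>. is_partition M \<alpha> \<and> finer \<alpha> \<U>} \<noteq> {}"
    using selector_partition by blast
  then show ?thesis
    unfolding h_plus_def using h_minus_le_dyn_entropy[OF U] by (intro cInf_greatest) auto
qed

lemma h_plus_le_selector:
  assumes U: "is_cover M \<U>" and F: "F \<in> selectors M \<U>"
  shows "h_plus b M T \<U> \<le> dyn_entropy b M T (fibres M F)"
  unfolding h_plus_def using h_minus_le_dyn_entropy[OF U] selector_partition[OF F]
  by (intro cInf_lower bdd_belowI[of _ "h_minus b M T \<U>"]) auto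

end

section \<open>Markers and towers\<close>

text \<open>The candidates \<open>D i\<close> are added in turn, except for those points that are too close (in the
  sense of the neighbourhood \<open>N\<close>) to a point added earlier.\<close>

primrec greedy_marker :: "(nat \<Rightarrow> 'a set) \<Rightarrow> ('a set \<Rightarrow> 'a set) \<Rightarrow> nat \<Rightarrow> 'a set" where
  "greedy_marker D N 0 = {}"
| "greedy_marker D N (Suc i) = greedy_marker D N i \<union> (D i - N (greedy_marker D N i))"

lemma greedy_marker_mono: "i \<le> j \<Longrightarrow> greedy_marker D N i \<subseteq> greedy_marker D N j"
  by (rule lift_Suc_mono_le[of "greedy_marker D N"]) auto

context measure_dynamical_system
begin

definition T_inv :: "'a \<Rightarrow> 'a" where "T_inv = inv_into (space M) T"

lemma T_inv_T: "x \<in> space M \<Longrightarrow> T_inv (T x) = x"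
  and T_T_inv: "x \<in> space M \<Longrightarrow> T (T_inv x) = x"
  using T_bij by (auto simp: T_inv_def bij_betw_def f_inv_into_f)

lemma T_inv_iter_measurable: "(T_inv ^^ n) \<in> measurable M M"
  unfolding T_inv_def by (rule measurable_compose_n[OF T_inv_measurable])

lemma T_inv_iter_space: "x \<in> space M \<Longrightarrow> (T_inv ^^ n) x \<in> space M"
  using measurable_space[OF T_inv_iter_measurable] by blast

lemma T_inv_iter_cancel: "x \<in> space M \<Longrightarrow> (T_inv ^^ n) ((T ^^ n) x) = x"
proof (induction n)
  case (Suc n)
  have "(T_inv ^^ Suc n) ((T ^^ Suc n) x) = (T_inv ^^ n) (T_inv (T ((T ^^ n) x)))"
    unfolding funpow_Suc_right[of n T_inv] by simp
  then show ?case using Suc T_inv_T[OF iter_space[OF Suc.prems]] by simp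
qed simp

lemma T_iter_inv_cancel: "x \<in> space M \<Longrightarrow> (T ^^ n) ((T_inv ^^ n) x) = x"
proof (induction n)
  case (Suc n)
  have "(T ^^ Suc n) ((T_inv ^^ Suc n) x) = (T ^^ n) (T (T_inv ((T_inv ^^ n) x)))"
    unfolding funpow_Suc_right[of n T] by simp
  then show ?case using Suc T_T_inv[OF T_inv_iter_space[OF Suc.prems]] by simp
qed simp

lemma T_iter_inv_ge:
  assumes "x \<in> space M" "k \<le> n" shows "(T ^^ n) ((T_inv ^^ k) x) = (T ^^ (n - k)) x"
proof -
  have "(T ^^ n) ((T_inv ^^ k) x) = (T ^^ (n - k)) ((T ^^ k) ((T_inv ^^ k) x))"
    using assms(2) by (simp add: funpow_funpow)
  then show ?thesis using T_iter_inv_cancel[OF assms(1)] by simp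
qed

lemma T_iter_inv_le:
  assumes "x \<in> space M" "n \<le> k" shows "(T ^^ n) ((T_inv ^^ k) x) = (T_inv ^^ (k - n)) x"
proof -
  have "(T_inv ^^ k) x = (T_inv ^^ n) ((T_inv ^^ (k - n)) x)"
    using assms(2) by (simp add: funpow_funpow)
  then show ?thesis using T_iter_inv_cancel[OF T_inv_iter_space[OF assms(1)]] by simp
qed

lemma T_inv_iter_le:
  assumes "x \<in> space M" "k \<le> n" shows "(T_inv ^^ k) ((T ^^ n) x) = (T ^^ (n - k)) x"
proof -
  have "(T ^^ n) x = (T ^^ k) ((T ^^ (n - k)) x)"
    using assms(2) by (simp add: funpow_funpow)
  then show ?thesis using T_inv_iter_cancel[OF iter_space[OF assms(1)]] by simp
qed

lemma prob_vimage_T_inv_iter: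
  assumes "A \<in> sets M" shows "prob ((T_inv ^^ n) -` A \<inter> space M) = prob A"
proof -
  have "(T ^^ n) -` ((T_inv ^^ n) -` A \<inter> space M) \<inter> space M = A"
    using T_inv_iter_cancel iter_space sets.sets_into_space[OF assms] by auto
  then show ?thesis
    using prob_vimage_iter[OF measurable_sets[OF T_inv_iter_measurable assms, of n], of n] by simp
qed

text \<open>The preimages of \<open>A\<close> under the first \<open>n\<close> iterates are disjoint and have the measure of
  \<open>A\<close>.\<close>

lemma prob_separated_le:
  assumes A: "A \<in> sets M" and sep: "\<And>x k. x \<in> A \<Longrightarrow> 1 \<le> k \<Longrightarrow> k < n \<Longrightarrow> (T ^^ k) x \<notin> A"
  shows "real n * prob A \<le> 1"
proof -
  define B where "B i = (T ^^ i) -` A \<inter> space M" for i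
  have B: "B i \<in> sets M" for i
    unfolding B_def by (rule measurable_sets[OF iter_measurable A])
  have ne: "B i \<inter> B j = {}" if "i < j" "j < n" for i j
  proof -
    have "(T ^^ j) x = (T ^^ (j - i)) ((T ^^ i) x)" for x
      using that by (simp add: funpow_funpow)
    then show ?thesis using sep[of _ "j - i"] that by (auto simp: B_def)
  qed
  have disj: "disjoint_family_on B {..<n}"
    unfolding disjoint_family_on_def
  proof (intro ballI impI)
    fix i j assume "i \<in> {..<n}" "j \<in> {..<n}" "i \<noteq> j"
    then show "B i \<inter> B j = {}" using ne[of i j] ne[of j i] by (cases "i < j") auto
  qed
  have "real n * prob A = (\<Sum>i<n. prob (B i))"
    unfolding B_def using prob_vimage_iter[OF A] by simp
  also have "\<dots> = prob (\<Union>i<n. B i)"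
    using B disj by (intro finite_measure_finite_Union[symmetric]) auto
  also have "\<dots> \<le> 1" by simp
  finally show ?thesis .
qed

text \<open>This is the one place where the hypothesis on the measurable space enters: finitely many
  distinct points can be separated by sets from a fixed countable family.\<close>

lemma standard_embedding:
  obtains f :: "'a \<Rightarrow> real" where "f \<in> borel_measurable M" "inj_on f (space M)"
proof -
  obtain f where f: "bij_betw f (space M) (space (restrict_space borel {0..1::real}))"
    "f \<in> measurable M (restrict_space borel {0..1::real})"
    using standard by (auto simp: standard_space_def measurable_isomorphic_def)
  then show ?thesis
    using that[of f] by (auto simp: bij_betw_def measurable_restrict_space2_iff)
qed

text \<open>Points of period at most \<open>m\<close> have to be treated apart, since they return within \<open>m\<close> steps
  to every set that contains them.\<close>

definition long_period :: "nat \<Rightarrow> 'a set" where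
  "long_period m = {x \<in> space M. \<forall>k\<in>{1..m}. (T ^^ k) x \<noteq> x}"

lemma long_period_sets: "long_period m \<in> sets M"
proof -
  obtain f :: "'a \<Rightarrow> real" where f: "f \<in> borel_measurable M" "inj_on f (space M)"
    using standard_embedding .
  have [measurable]: "f \<in> borel_measurable M" "\<And>k. (\<lambda>x. f ((T ^^ k) x)) \<in> borel_measurable M"
    using f(1) measurable_compose[OF iter_measurable f(1)] by auto
  have "long_period m = {x \<in> space M. \<forall>k\<in>{1..m}. f ((T ^^ k) x) \<noteq> f x}"
    unfolding long_period_def using f(2) iter_space by (auto simp: inj_on_def)
  then show ?thesis by simp
qed

lemma long_period_iter: "x \<in> space M \<Longrightarrow> (T ^^ j) x \<in> long_period m \<longleftrightarrow> x \<in> long_period m"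
proof -
  assume x: "x \<in> space M"
  have "(T ^^ k) ((T ^^ j) x) = (T ^^ j) x \<longleftrightarrow> (T ^^ k) x = x" for k
  proof -
    have c: "(T ^^ k) ((T ^^ j) x) = (T ^^ j) ((T ^^ k) x)"
      by (simp add: funpow_funpow add.commute)
    show ?thesis
      unfolding c using T_inv_iter_cancel[OF x, of j] T_inv_iter_cancel[OF iter_space[OF x], of j k]
      by metis
  qed
  then show ?thesis using x iter_space by (simp add: long_period_def)
qed

text \<open>For a point \<open>x\<close> of long period some basic open set contains the image of \<open>x\<close> but none of
  the images of its next \<open>m\<close> iterates; \<open>D i\<close> collects the points for which the \<open>i\<close>-th basic
  set does this.\<close>

lemma separating_sets:
  obtains D :: "nat \<Rightarrow> 'a set" where "\<And>i. D i \<in> sets M"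
    "\<And>i x k. x \<in> D i \<Longrightarrow> 1 \<le> k \<Longrightarrow> k \<le> m \<Longrightarrow> (T ^^ k) x \<notin> D i"
    "long_period m \<subseteq> (\<Union>i. D i)"
proof -
  obtain f :: "'a \<Rightarrow> real" where f: "f \<in> borel_measurable M" "inj_on f (space M)"
    using standard_embedding .
  have fk [measurable]: "f \<in> borel_measurable M" "\<And>k. (\<lambda>x. f ((T ^^ k) x)) \<in> borel_measurable M"
    using f(1) measurable_compose[OF iter_measurable f(1)] by auto
  obtain B :: "real set set" where B: "countable B" "topological_basis B"
    using ex_countable_basis by blast
  then have ne: "B \<noteq> {}" using topological_basisE[of B UNIV 0] by auto
  define J where "J = from_nat_into B"
  have J: "J i \<in> B" "open (J i)" for i
    using from_nat_into[OF ne] topological_basis_open[OF B(2)] by (auto simp: J_def)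
  define D where "D i = {x \<in> space M. f x \<in> J i \<and> (\<forall>k\<in>{1..m}. f ((T ^^ k) x) \<notin> J i)}" for i
  show ?thesis
  proof (rule that)
    fix i
    have [measurable]: "J i \<in> sets borel" using J by simp
    show "D i \<in> sets M" unfolding D_def by measurable
    fix x k assume "x \<in> D i" "1 \<le> k" "k \<le> m"
    then show "(T ^^ k) x \<notin> D i" by (auto simp: D_def)
  next
    show "long_period m \<subseteq> (\<Union>i. D i)"
    proof
      fix x assume x: "x \<in> long_period m"
      define F where "F = (\<lambda>k. f ((T ^^ k) x)) ` {1..m}"
      have "f x \<notin> F"
      proof
        assume "f x \<in> F"
        then obtain k where k: "k \<in> {1..m}" "f ((T ^^ k) x) = f x" by (auto simp: F_def)
        then have "(T ^^ k) x = x"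
          using x inj_onD[OF f(2) k(2) iter_space] by (simp add: long_period_def)
        then show False using x k(1) by (simp add: long_period_def)
      qed
      moreover have "open (- F)" by (intro open_Compl finite_imp_closed) (simp add: F_def)
      ultimately obtain K where K: "K \<in> B" "f x \<in> K" "K \<subseteq> - F"
        using topological_basisE[OF B(2), of "- F" "f x"] by auto
      obtain i where "K = J i"
        using from_nat_into_surj[OF B(1) K(1)] by (auto simp: J_def)
      then have "x \<in> D i" using K x by (auto simp: D_def F_def long_period_def)
      then show "x \<in> (\<Union>i. D i)" by blast
    qed
  qed
qed

text \<open>A maximal set which no orbit meets twice within \<open>m\<close> steps. A point of long period that is
  kept out by the greedy construction lies within \<open>m\<close> steps of a point of \<open>A\<close>, in the past
  or in the future. Arguing about the \<open>m\<close>-th iterate instead of the point itself puts this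
  visit to \<open>A\<close> into the future in both cases.\<close>

lemma marker_set:
  obtains A where "A \<in> sets M"
    "\<And>x k. x \<in> A \<Longrightarrow> 1 \<le> k \<Longrightarrow> k \<le> m \<Longrightarrow> (T ^^ k) x \<notin> A"
    "\<And>x. x \<in> long_period m \<Longrightarrow> \<exists>j. (T ^^ j) x \<in> A"
proof -
  obtain D :: "nat \<Rightarrow> 'a set" where D: "\<And>i. D i \<in> sets M"
    "\<And>i x k. x \<in> D i \<Longrightarrow> 1 \<le> k \<Longrightarrow> k \<le> m \<Longrightarrow> (T ^^ k) x \<notin> D i"
    "long_period m \<subseteq> (\<Union>i. D i)"
    using separating_sets[of m] by blast
  define N where "N X = (\<Union>k\<in>{1..m}. (T ^^ k) -` X \<inter> space M) \<union> (\<Union>k\<in>{1..m}. (T_inv ^^ k) -` X \<inter> space M)" for X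
  define G where "G = greedy_marker D N"
  have G_Suc: "G (Suc i) = G i \<union> (D i - N (G i))" and G_0: "G 0 = {}" for i
    by (simp_all add: G_def)
  have G_sets: "G i \<in> sets M" for i
  proof (induction i)
    case (Suc i)
    have "N (G i) \<in> sets M"
      unfolding N_def using measurable_sets[OF iter_measurable Suc] measurable_sets[OF T_inv_iter_measurable Suc]
      by (intro sets.Un sets.finite_UN) auto
    then show ?case unfolding G_Suc using D(1) Suc by auto
  qed (simp add: G_0)
  have G_sep: "(T ^^ k) x \<notin> G i" if "x \<in> G i" "1 \<le> k" "k \<le> m" for x k i
    using that
  proof (induction i)
    case (Suc i)
    have x: "x \<in> space M" using Suc.prems(1) sets.sets_into_space[OF G_sets] by blast
    have k: "k \<in> {1..m}" using Suc.prems by simp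
    show ?case
    proof
      assume Tx: "(T ^^ k) x \<in> G (Suc i)"
      consider "x \<in> G i" "(T ^^ k) x \<in> G i" | "x \<in> G i" "(T ^^ k) x \<in> D i - N (G i)"
        | "x \<in> D i - N (G i)" "(T ^^ k) x \<in> G i" | "x \<in> D i" "(T ^^ k) x \<in> D i"
        using Tx Suc.prems(1) unfolding G_Suc by blast
      then show False
      proof cases
        case 1 then show ?thesis using Suc by simp
      next
        case 2
        then have "(T ^^ k) x \<in> N (G i)"
          unfolding N_def using k iter_space[OF x] T_inv_iter_cancel[OF x, of k] by fastforce
        then show ?thesis using 2 by blast
      next
        case 3
        then have "x \<in> N (G i)" unfolding N_def using k x by blast
        then show ?thesis using 3 by blast
      next
        case 4 then show ?thesis using D(2) Suc.prems by blast
      qed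
    qed
  qed (simp add: G_0)
  show ?thesis
  proof (rule that[of "\<Union>i. G i"])
    show "(\<Union>i. G i) \<in> sets M" using G_sets by auto
  next
    fix x k assume x: "x \<in> (\<Union>i. G i)" and k: "1 \<le> k" "k \<le> m"
    show "(T ^^ k) x \<notin> (\<Union>i. G i)"
    proof
      assume "(T ^^ k) x \<in> (\<Union>i. G i)"
      then obtain i j where ij: "x \<in> G i" "(T ^^ k) x \<in> G j" using x by blast
      have "G i \<subseteq> G (max i j)" "G j \<subseteq> G (max i j)"
        unfolding G_def by (intro greedy_marker_mono; simp)+
      then show False using G_sep[of x "max i j" k] ij k by blast
    qed
  next
    fix x assume x: "x \<in> long_period m"
    then have xs: "x \<in> space M" by (simp add: long_period_def)
    define y where "y = (T ^^ m) x"
    have y: "y \<in> long_period m" "y \<in> space M"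
      using x long_period_iter[OF xs, of m m] iter_space[OF xs] by (auto simp: y_def)
    obtain i where i: "y \<in> D i" using D(3) y(1) by blast
    consider "y \<in> G (Suc i)" | k where "k \<in> {1..m}" "(T ^^ k) y \<in> G i"
      | k where "k \<in> {1..m}" "(T_inv ^^ k) y \<in> G i"
      using i y(2) unfolding G_Suc N_def by blast
    then show "\<exists>j. (T ^^ j) x \<in> (\<Union>i. G i)"
    proof cases
      case 1 then show ?thesis unfolding y_def by blast
    next
      case 2
      then have "(T ^^ (k + m)) x \<in> (\<Union>i. G i)" by (auto simp: y_def funpow_add)
      then show ?thesis by blast
    next
      case 3
      then have "(T ^^ (m - k)) x \<in> (\<Union>i. G i)"
        using T_inv_iter_le[OF xs, of k m] by (auto simp: y_def)
      then show ?thesis by blast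
    qed
  qed
qed

text \<open>The marker set cuts an orbit into intervals of length more than \<open>m\<close>. Each interval is cut,
  counting back from its end, into blocks of length \<open>n\<close>, where the cuts are made at the
  times congruent to \<open>j\<close> modulo \<open>n\<close>; \<open>C j\<close> is the set of the starting points of blocks. For
  fixed \<open>j\<close> the blocks are disjoint, so \<open>C j\<close> is the base of a tower of height \<open>n\<close> and has
  measure at most \<open>1 / n\<close>. Different phases \<open>j\<close> have disjoint bases. The tower misses only
  points of an interval within \<open>n\<close> steps of one of its ends, and these are rare when \<open>m\<close> is
  much larger than \<open>n\<close>.\<close>

lemma tower_phases:
  assumes n: "0 < n"
  obtains C :: "nat \<Rightarrow> 'a set" where "\<And>j. C j \<in> sets M"
    "\<And>i j. i \<noteq> j \<Longrightarrow> C i \<inter> C j = {}"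
    "\<And>j. real n * prob (C j) \<le> 1"
    "\<And>j. j < n \<Longrightarrow>
      prob {y \<in> long_period m. \<forall>t<n. (T_inv ^^ t) y \<notin> C j} \<le> 2 * real n / real (m + 1)"
proof -
  obtain A where A: "A \<in> sets M"
    "\<And>x k. x \<in> A \<Longrightarrow> 1 \<le> k \<Longrightarrow> k \<le> m \<Longrightarrow> (T ^^ k) x \<notin> A"
    "\<And>x. x \<in> long_period m \<Longrightarrow> \<exists>j. (T ^^ j) x \<in> A"
    using marker_set[of m] by blast
  have pA: "prob A \<le> 1 / real (m + 1)"
    using prob_separated_le[OF A(1), of "m + 1"] A(2) by (simp add: field_simps)
  define R where "R q = {x \<in> space M. (T ^^ q) x \<in> A \<and> (\<forall>i<q. (T ^^ i) x \<notin> A)}" for q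
  have R_sets: "R q \<in> sets M" for q
  proof -
    have [measurable]: "A \<in> sets M" "\<And>k. (\<lambda>x. (T ^^ k) x) \<in> measurable M M"
      using A(1) iter_measurable by auto
    show ?thesis unfolding R_def by measurable
  qed
  have R_disj: "p = q" if "x \<in> R p" "x \<in> R q" for x p q
    using that by (auto simp: R_def dest: linorder_neqE_nat)
  have R_shift: "(T ^^ t) x \<in> R (q - t)" if x: "x \<in> R q" and t: "t \<le> q" for x q t
  proof -
    have c: "(T ^^ i) ((T ^^ t) x) = (T ^^ (i + t)) x" for i by (simp add: funpow_add)
    show ?thesis using x t iter_space by (auto simp: R_def c)
  qed
  define C where "C j = (\<Union>q\<in>{q. n - 1 \<le> q \<and> q mod n = j}. R q)" for j
  have C_sets: "C j \<in> sets M" for j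
    unfolding C_def using R_sets by (intro sets.countable_UN') auto
  show ?thesis
  proof (rule that)
    show "C j \<in> sets M" for j by (rule C_sets)
  next
    fix i j :: nat assume "i \<noteq> j"
    then show "C i \<inter> C j = {}" using R_disj by (auto simp: C_def)
  next
    fix j
    show "real n * prob (C j) \<le> 1"
    proof (rule prob_separated_le[OF C_sets])
      fix x k assume x: "x \<in> C j" and k: "1 \<le> k" "k < n"
      then obtain q where q: "n - 1 \<le> q" "q mod n = j" "x \<in> R q" by (auto simp: C_def)
      show "(T ^^ k) x \<notin> C j"
      proof
        assume "(T ^^ k) x \<in> C j"
        then obtain p where p: "p mod n = j" "(T ^^ k) x \<in> R p" by (auto simp: C_def)
        have "k \<le> q" using k q(1) by linarith
        then have "p = q - k" using R_shift[OF q(3)] R_disj p(2) by blast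
        then have "(p + k) mod n = p mod n" using \<open>k \<le> q\<close> p(1) q(2) by simp
        then have "n dvd k" using n by (metis add_diff_cancel_left' mod_eq_dvd_iff_nat le_add1)
        then show False using k by (auto dest: dvd_imp_le)
      qed
    qed
  next
    fix j assume j: "j < n"
    let ?E = "{y \<in> long_period m. \<forall>t<n. (T_inv ^^ t) y \<notin> C j}"
    let ?P = "\<Union>t<n. (T ^^ t) -` A \<inter> space M" and ?Q = "\<Union>t\<in>{1..n}. (T_inv ^^ t) -` A \<inter> space M"
    have "?E \<subseteq> ?P \<union> ?Q"
    proof
      fix y assume y: "y \<in> ?E"
      then have ys: "y \<in> space M" by (simp add: long_period_def)
      show "y \<in> ?P \<union> ?Q"
      proof (rule ccontr)
        assume contra: "y \<notin> ?P \<union> ?Q"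
        define s where "s = (LEAST s. (T ^^ s) y \<in> A)"
        have s: "(T ^^ s) y \<in> A" "\<And>i. i < s \<Longrightarrow> (T ^^ i) y \<notin> A"
          using A(3)[of y] y LeastI_ex[of "\<lambda>s. (T ^^ s) y \<in> A"] not_less_Least
          unfolding s_def by blast+
        have sn: "n \<le> s" using contra s(1) ys by (meson UN_I IntI UnI1 lessThan_iff linorder_not_less vimageI)
        \<comment> \<open>Moving back \<open>t\<close> steps makes the time until the next visit to \<open>A\<close> congruent to \<open>j\<close>.\<close>
        define t where "t = (j + (n - s mod n)) mod n"
        have t: "t < n" using n by (simp add: t_def)
        have "(s + t) mod n = (s mod n + (j + (n - s mod n))) mod n"
          unfolding t_def by (simp add: mod_add_eq mod_simps)
        also have "s mod n + (j + (n - s mod n)) = j + n"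
          using mod_less_divisor[OF n, of s] by linarith
        also have "(j + n) mod n = j" using j by simp
        finally have st: "(s + t) mod n = j" .
        have "(T_inv ^^ t) y \<in> R (s + t)"
          unfolding R_def
        proof (intro CollectI conjI allI impI)
          show "(T_inv ^^ t) y \<in> space M" by (rule T_inv_iter_space[OF ys])
          show "(T ^^ (s + t)) ((T_inv ^^ t) y) \<in> A" using T_iter_inv_ge[OF ys, of t "s + t"] s(1) by simp
          fix i assume i: "i < s + t"
          show "(T ^^ i) ((T_inv ^^ t) y) \<notin> A"
          proof (cases "t \<le> i")
            case True
            then show ?thesis using T_iter_inv_ge[OF ys True] s(2)[of "i - t"] i by simp
          next
            case False
            then have "t - i \<in> {1..n}" using t by auto
            then show ?thesis using T_iter_inv_le[OF ys, of i t] contra ys False by auto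
          qed
        qed
        then have "(T_inv ^^ t) y \<in> C j" using sn st unfolding C_def by (intro UN_I[of "s + t"]) auto
        then show False using y t by blast
      qed
    qed
    moreover have PQ: "?P \<in> sets M" "?Q \<in> sets M"
      using measurable_sets[OF iter_measurable A(1)] measurable_sets[OF T_inv_iter_measurable A(1)]
      by (intro sets.finite_UN; simp)+
    ultimately have "prob ?E \<le> prob (?P \<union> ?Q)"
      by (intro finite_measure_mono sets.Un)
    also have "\<dots> \<le> prob ?P + prob ?Q"
      by (rule measure_Un_le[OF PQ])
    also have "prob ?P \<le> (\<Sum>t<n. prob ((T ^^ t) -` A \<inter> space M))"
      using measurable_sets[OF iter_measurable A(1)] by (intro finite_measure_subadditive_finite) auto
    also have "\<dots> = real n * prob A" using prob_vimage_iter[OF A(1)] by simp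
    also have "prob ?Q \<le> (\<Sum>t\<in>{1..n}. prob ((T_inv ^^ t) -` A \<inter> space M))"
      using measurable_sets[OF T_inv_iter_measurable A(1)] by (intro finite_measure_subadditive_finite) auto
    also have "\<dots> = real n * prob A" using prob_vimage_T_inv_iter[OF A(1)] by simp
    finally have "prob ?E \<le> 2 * real n * prob A" by simp
    also have "\<dots> \<le> 2 * real n * (1 / real (m + 1))" using pA by (intro mult_left_mono) auto
    finally show "prob ?E \<le> 2 * real n / real (m + 1)" by simp
  qed
qed

end

section \<open>Coding by the blocks of a tower\<close>

definition masked :: "'a set \<Rightarrow> ('a \<Rightarrow> 'c) \<Rightarrow> 'a \<Rightarrow> 'c option" where
  "masked C F x = (if x \<in> C then Some (F x) else None)"

lemma simple_function_masked:
  assumes F: "simple_function M F" and C: "C \<in> sets M"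
  shows "simple_function M (masked C F)"
proof -
  have "simple_function M (\<lambda>x. if x \<in> C then Some (F x) else None)"
    using simple_function_compose[OF F, of Some] C
    by (intro simple_function_If_set) (auto simp: comp_def sets.Int_space_eq2)
  then show ?thesis by (simp add: masked_def[abs_def])
qed

context information_space
begin

text \<open>Crude explicit bounds with a power of \<open>p\<close> are enough, and they spare all continuity
  arguments: both follow from \<open>ln x \<le> x - 1\<close>, the first one for \<open>x = 1 / sqrt p\<close>, the
  second one for \<open>x = 1 / (1 - p)\<close>.\<close>

lemma neg_log_le_sqrt:
  assumes "0 \<le> p" "p \<le> 1" shows "- (p * log b p) \<le> 2 * sqrt p / ln b"
proof (cases "p = 0")
  case False
  then have p: "0 < p" "0 < sqrt p" using assms by auto
  have "- ln (sqrt p) \<le> 1 / sqrt p - 1"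
    using ln_le_minus_one[of "1 / sqrt p"] p by (simp add: ln_div)
  then have "- ln p \<le> 2 / sqrt p" using p by (simp add: ln_sqrt)
  then have "p * - ln p \<le> p * (2 / sqrt p)" using p by (intro mult_left_mono) auto
  also have "p * (2 / sqrt p) = 2 * sqrt p" using p real_sqrt_mult_self[of p] by (simp add: field_simps)
  finally have "- (p * ln p) / ln b \<le> 2 * sqrt p / ln b"
    using b_gt_1 by (intro divide_right_mono) auto
  then show ?thesis by (simp add: log_def)
qed simp

lemma neg_log_compl_le_sqrt:
  assumes "0 \<le> p" "p \<le> 1" shows "- ((1 - p) * log b (1 - p)) \<le> sqrt p / ln b"
proof (cases "p = 1")
  case False
  then have p: "0 < 1 - p" using assms by auto
  have "- ln (1 - p) \<le> 1 / (1 - p) - 1"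
    using ln_le_minus_one[of "1 / (1 - p)"] p by (simp add: ln_div)
  then have "(1 - p) * - ln (1 - p) \<le> (1 - p) * (1 / (1 - p) - 1)"
    using p by (intro mult_left_mono) auto
  also have "\<dots> = p" using p by (simp add: field_simps)
  also have "p \<le> sqrt p" using assms by (intro real_le_rsqrt) (simp add: power2_eq_square mult_left_le)
  finally have "- ((1 - p) * ln (1 - p)) / ln b \<le> sqrt p / ln b"
    using b_gt_1 by (intro divide_right_mono) auto
  then show ?thesis by (simp add: log_def)
qed (use b_gt_1 in simp)

lemma entropy_masked_eq:
  assumes F: "simple_function M F" and C: "C \<in> sets M"
  shows "\<H>(masked C F) = - ((1 - prob C) * log b (1 - prob C))
    - (\<Sum>c\<in>F ` space M. prob (F -` {c} \<inter> C) * log b (prob (F -` {c} \<inter> C)))"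
proof -
  let ?S = "insert None (Some ` F ` space M)"
  have fin: "finite (F ` space M)" using simple_functionD(1)[OF F] .
  have sub: "masked C F ` space M \<subseteq> ?S" by (auto simp: masked_def)
  have Csp: "C \<subseteq> space M" using sets.sets_into_space[OF C] .
  have N: "masked C F -` {None} \<inter> space M = space M - C" by (auto simp: masked_def split: if_splits)
  have S: "masked C F -` {Some c} \<inter> space M = F -` {c} \<inter> C" for c
    using Csp by (auto simp: masked_def split: if_splits)
  have "\<H>(masked C F) = - (\<Sum>c\<in>?S. prob (masked C F -` {c} \<inter> space M) * log b (prob (masked C F -` {c} \<inter> space M)))"
    using fin by (intro entropy_eq_sum_superset simple_function_masked F C sub) auto
  also have "\<dots> = - ((1 - prob C) * log b (1 - prob C))
    - (\<Sum>c\<in>F ` space M. prob (F -` {c} \<inter> C) * log b (prob (F -` {c} \<inter> C)))"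
    using fin by (subst sum.insert) (auto simp: N S sum.reindex prob_compl[OF C])
  finally show ?thesis .
qed

lemma entropy_masked_le:
  assumes F: "simple_function M F" and C: "C \<in> sets M"
  shows "\<H>(masked C F) \<le> (2 * real (card (F ` space M)) + 1) * sqrt (prob C) / ln b"
proof -
  have lnb: "0 < ln b" using b_gt_1 by simp
  have "- (\<Sum>c\<in>F ` space M. prob (F -` {c} \<inter> C) * log b (prob (F -` {c} \<inter> C)))
      = (\<Sum>c\<in>F ` space M. - (prob (F -` {c} \<inter> C) * log b (prob (F -` {c} \<inter> C))))"
    by (simp add: sum_negf)
  also have "\<dots> \<le> (\<Sum>c\<in>F ` space M. 2 * sqrt (prob C) / ln b)"
  proof (rule sum_mono)
    fix c
    have "prob (F -` {c} \<inter> C) \<le> prob C" using C by (intro finite_measure_mono) auto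
    then have "2 * sqrt (prob (F -` {c} \<inter> C)) / ln b \<le> 2 * sqrt (prob C) / ln b"
      using lnb by (intro divide_right_mono) auto
    then show "- (prob (F -` {c} \<inter> C) * log b (prob (F -` {c} \<inter> C))) \<le> 2 * sqrt (prob C) / ln b"
      using neg_log_le_sqrt[of "prob (F -` {c} \<inter> C)"] by simp
  qed
  finally show ?thesis
    unfolding entropy_masked_eq[OF F C]
    using neg_log_compl_le_sqrt[of "prob C"] by (simp add: add_divide_distrib distrib_right algebra_simps)
qed

text \<open>The corrections subtract from the entropy of a masked function the part that is spent on
  telling whether the point lies in \<open>C j\<close>. What remains is the contribution of \<open>C j\<close> to the
  conditional entropy of \<open>F\<close> given the partition into the sets \<open>C j\<close> and the rest, which is
  at most the entropy of \<open>F\<close>. Consequently one of \<open>n\<close> disjoint sets carries at most \<open>1 / n\<close>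
  of the entropy of \<open>F\<close>.\<close>

lemma sum_entropy_masked_le:
  fixes C :: "nat \<Rightarrow> 'a set"
  assumes F: "simple_function M F" and C: "\<And>j. C j \<in> sets M"
    and disj: "\<And>i j. i \<noteq> j \<Longrightarrow> C i \<inter> C j = {}"
  shows "(\<Sum>j<n. \<H>(masked (C j) F) + (prob (C j) * log b (prob (C j)) + (1 - prob (C j)) * log b (1 - prob (C j))))
    \<le> \<H>(F)"
proof -
  define D where "D j = (if j < n then C j else space M - (\<Union>i<n. C i))" for j :: nat
  have D: "D j \<in> sets M" for j unfolding D_def using C by auto
  define J where "J x = (LEAST j. x \<in> D j)" for x
  have ex: "\<exists>j\<le>n. x \<in> D j" if "x \<in> space M" for x
    using that by (auto simp: D_def intro: less_imp_le)
  have uniq: "i = j" if "x \<in> D i" "x \<in> D j" "i \<le> n" "j \<le> n" for x i j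
    using that disj[of i j] by (auto simp: D_def split: if_splits)
  have J_le: "J x \<le> n" and J_in: "x \<in> D (J x)" if x: "x \<in> space M" for x
  proof -
    obtain j where j: "j \<le> n" "x \<in> D j" using ex[OF x] by blast
    show "x \<in> D (J x)" unfolding J_def using j(2) by (rule LeastI)
    have "J x \<le> j" unfolding J_def using j(2) by (rule Least_le)
    then show "J x \<le> n" using j(1) by simp
  qed
  have J_iff: "J x = j \<longleftrightarrow> x \<in> D j" if "x \<in> space M" "j \<le> n" for x j
    using that J_in J_le uniq by blast
  have Dsp: "D j \<subseteq> space M" for j using sets.sets_into_space[OF D] .
  have J_fib: "J -` {j} \<inter> space M = D j" if "j \<le> n" for j
    using J_iff[OF _ that] Dsp by auto
  have J_im: "J ` space M \<subseteq> {..n}" using J_le by auto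
  have sJ: "simple_function M J"
    unfolding simple_function_def
  proof
    show "finite (J ` space M)" using J_im finite_subset by blast
    show "\<forall>j\<in>J ` space M. J -` {j} \<inter> space M \<in> sets M" using J_im J_fib D by auto
  qed
  define p where "p c j = prob (F -` {c} \<inter> D j)" for c j
  let ?Q = "F ` space M"
  have fin: "finite ?Q" using simple_functionD(1)[OF F] .
  have FD: "F -` {c} \<inter> D j \<in> sets M" for c j
  proof -
    have "F -` {c} \<inter> D j = (F -` {c} \<inter> space M) \<inter> D j" using Dsp by auto
    then show ?thesis using simple_functionD(2)[OF F] D by auto
  qed
  have pair: "\<H>(\<lambda>x. (F x, J x)) = - (\<Sum>j\<le>n. \<Sum>c\<in>?Q. p c j * log b (p c j))"
  proof -
    have fib: "(\<lambda>x. (F x, J x)) -` {(c, j)} \<inter> space M = F -` {c} \<inter> D j" if "j \<le> n" for c j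
      using J_iff[OF _ that] Dsp by auto
    have "\<H>(\<lambda>x. (F x, J x)) = - (\<Sum>z\<in>?Q \<times> {..n}. prob ((\<lambda>x. (F x, J x)) -` {z} \<inter> space M)
        * log b (prob ((\<lambda>x. (F x, J x)) -` {z} \<inter> space M)))"
      using fin J_im by (intro entropy_eq_sum_superset simple_function_Pair F sJ) auto
    also have "\<dots> = - (\<Sum>c\<in>?Q. \<Sum>j\<le>n. p c j * log b (p c j))"
      unfolding sum.cartesian_product p_def
      by (intro arg_cong[where f = uminus] sum.cong) (auto simp: fib)
    also have "\<dots> = - (\<Sum>j\<le>n. \<Sum>c\<in>?Q. p c j * log b (p c j))"
      by (subst sum.swap) simp
    finally show ?thesis .
  qed
  have HJ: "\<H>(J) = - (\<Sum>j\<le>n. prob (D j) * log b (prob (D j)))"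
    unfolding entropy_eq_sum_superset[OF sJ _ J_im, simplified] using J_fib by simp
  define G where "G j = prob (D j) * log b (prob (D j)) - (\<Sum>c\<in>?Q. p c j * log b (p c j))" for j
  have G_nonneg: "0 \<le> G j" for j
  proof -
    have "prob (D j) = prob (\<Union>c\<in>?Q. F -` {c} \<inter> D j)"
      using Dsp by (intro arg_cong[where f = prob]) auto
    also have "\<dots> = (\<Sum>c\<in>?Q. p c j)"
      unfolding p_def using FD fin by (intro finite_measure_finite_Union) (auto simp: disjoint_family_on_def)
    finally have tot: "prob (D j) = (\<Sum>c\<in>?Q. p c j)" .
    have "p c j * log b (p c j) \<le> p c j * log b (prob (D j))" for c
    proof (cases "p c j = 0")
      case False
      have "p c j \<le> prob (D j)" unfolding p_def using D by (intro finite_measure_mono) auto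
      moreover have "0 < p c j" using False measure_nonneg[of M] by (auto simp: p_def less_le)
      ultimately show ?thesis using b_gt_1 by (intro mult_left_mono log_mono) auto
    qed simp
    then have "(\<Sum>c\<in>?Q. p c j * log b (p c j)) \<le> (\<Sum>c\<in>?Q. p c j * log b (prob (D j)))"
      by (intro sum_mono)
    also have "\<dots> = prob (D j) * log b (prob (D j))" unfolding tot by (simp add: sum_distrib_right)
    finally show ?thesis by (simp add: G_def)
  qed
  have "(\<Sum>j<n. \<H>(masked (C j) F) + (prob (C j) * log b (prob (C j)) + (1 - prob (C j)) * log b (1 - prob (C j))))
      = (\<Sum>j<n. G j)"
    by (intro sum.cong refl) (simp add: entropy_masked_eq[OF F C] G_def D_def p_def)
  also have "\<dots> \<le> (\<Sum>j\<le>n. G j)" using G_nonneg by (intro sum_mono2) auto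
  also have "\<dots> = \<H>(\<lambda>x. (F x, J x)) - \<H>(J)"
    unfolding pair HJ G_def by (simp add: sum_subtractf)
  also have "\<dots> \<le> \<H>(F)" using entropy_pair_le[OF F sJ] by simp
  finally show ?thesis .
qed

end

context entropy_system
begin

lemma entropy_itinerary_le:
  assumes F: "simple_function M F" shows "\<H>(itinerary T F n) \<le> real n * \<H>(F)"
proof (induction n)
  case 0
  have "\<H>(itinerary T F 0) \<le> log b (card {[] :: 'b list})"
    by (intro entropy_le_log_card_superset simple_itinerary F) (auto simp: itinerary_def)
  then show ?case by simp
next
  case (Suc n)
  have "\<H>(itinerary T F 1) \<le> \<H>(F)"
    by (intro entropy_determined F) (simp add: itinerary_eq_iff)
  then show ?case
    using Suc entropy_itinerary_add[OF F, of n 1] by (simp add: algebra_simps)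
qed

text \<open>An itinerary repeats its first \<open>p\<close> entries, so the entropies of the itineraries stay
  bounded as \<open>n\<close> grows, and the entropy rate is zero.\<close>

lemma entropy_itinerary_periodic:
  assumes F: "simple_function M F" and p: "0 < p"
    and per: "\<And>x. x \<in> space M \<Longrightarrow> F ((T ^^ p) x) = F x"
  shows "\<H>(itinerary T F n) \<le> \<H>(itinerary T F p)"
proof (rule entropy_determined)
  show "simple_function M (itinerary T F p)" by (rule simple_itinerary[OF F])
  have mult: "F ((T ^^ (q * p + r)) x) = F ((T ^^ r) x)" if x: "x \<in> space M" for q r x
  proof (induction q)
    case (Suc q)
    have "F ((T ^^ (Suc q * p + r)) x) = F ((T ^^ p) ((T ^^ (q * p + r)) x))"
      by (simp add: funpow_funpow add.assoc)
    then show ?case using Suc per[OF iter_space[OF x]] by simp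
  qed simp
  fix x y assume x: "x \<in> space M" and y: "y \<in> space M" and eq: "itinerary T F p x = itinerary T F p y"
  have "F ((T ^^ i) x) = F ((T ^^ i) y)" for i
    using mult[OF x, of "i div p" "i mod p"] mult[OF y, of "i div p" "i mod p"] eq p
    by (simp add: itinerary_eq_iff)
  then show "itinerary T F n x = itinerary T F n y" by (simp add: itinerary_eq_iff)
qed

lemma iter_fact_short_period:
  assumes x: "x \<in> space M" "x \<notin> long_period m" shows "(T ^^ fact m) x = x"
proof -
  obtain k where k: "k \<in> {1..m}" "(T ^^ k) x = x" using x by (auto simp: long_period_def)
  have "(T ^^ (q * k)) x = x" for q :: nat
  proof (induction q)
    case (Suc q)
    have "(T ^^ (Suc q * k)) x = (T ^^ k) ((T ^^ (q * k)) x)" by (simp add: funpow_funpow)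
    then show ?case using Suc k by simp
  qed simp
  moreover have "k dvd fact m" using k(1) by (intro dvd_fact) auto
  then obtain q where "fact m = q * k" by (metis dvdE mult.commute)
  ultimately show ?thesis by simp
qed

text \<open>Let \<open>\<beta>\<close> choose for each point an element of the \<open>n\<close>-fold join, that is, a sequence
  of \<open>n\<close> elements of the cover through which its orbit passes. A selector \<open>\<sigma>\<close> for the
  cover itself is obtained by reading \<open>\<beta>\<close> only at the base \<open>C j\<close> of a tower, and using
  that sequence while climbing the tower. At the points outside the tower \<open>\<sigma>\<close> is some
  fixed selector \<open>F0\<close>.

  Itineraries of \<open>\<sigma>\<close> can be reconstructed from those of three functions: \<open>\<gamma>\<close>,
  which is \<open>\<beta>\<close> on the base; \<open>\<eta>\<close>, which is \<open>F0\<close> on the small set of points of long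
  period outside the tower; and \<open>\<zeta>\<close>, which is \<open>F0\<close> on the points of short period and
  has zero entropy rate. For a good choice of the phase \<open>j\<close> the entropy of \<open>\<gamma>\<close> is
  about that of \<open>\<beta>\<close> divided by \<open>n\<close>.\<close>

lemma h_plus_le_block_code:
  assumes U: "is_cover M \<U>" and n: "0 < n" and \<beta>: "\<beta> \<in> selectors M (iter_join M T \<U> n)"
  shows "h_plus b M T \<U> \<le> \<H>(\<beta>) / real n + (2 * real (card \<U>) + 4) / (sqrt (real n) * ln b)"
proof -
  have lnb: "0 < ln b" using b_gt_1 by simp
  have s\<beta>: "simple_function M \<beta>" using \<beta> by (simp add: selectors_def)
  \<comment> \<open>With this \<open>m\<close>, the part of \<open>long_period m\<close> outside the tower has measure at most
    \<open>2 * n / (m + 1) = 1 / n\<close>.\<close>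
  define m where "m = 2 * n\<^sup>2 - 1"
  obtain C where C: "\<And>j. C j \<in> sets M" "\<And>i j. i \<noteq> j \<Longrightarrow> C i \<inter> C j = {}"
    "\<And>j. real n * prob (C j) \<le> 1"
    "\<And>j. j < n \<Longrightarrow>
      prob {y \<in> long_period m. \<forall>t<n. (T_inv ^^ t) y \<notin> C j} \<le> 2 * real n / real (m + 1)"
    using tower_phases[OF n, of m] by blast
  let ?f = "\<lambda>j. \<H>(masked (C j) \<beta>) + (prob (C j) * log b (prob (C j)) + (1 - prob (C j)) * log b (1 - prob (C j)))"
  have "\<exists>j<n. ?f j \<le> \<H>(\<beta>) / real n"
  proof (rule ccontr)
    assume "\<not> ?thesis"
    then have "(\<Sum>j<n. \<H>(\<beta>) / real n) < (\<Sum>j<n. ?f j)"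
      using n by (intro sum_strict_mono) auto
    then show False using sum_entropy_masked_le[where C = C and n = n, OF s\<beta> C(1,2)] n by simp
  qed
  then obtain j where j: "j < n" "?f j \<le> \<H>(\<beta>) / real n" by blast
  define \<gamma> where "\<gamma> = masked (C j) \<beta>"
  have s\<gamma>: "simple_function M \<gamma>" unfolding \<gamma>_def by (rule simple_function_masked[OF s\<beta> C(1)])
  have H\<gamma>: "\<H>(\<gamma>) \<le> \<H>(\<beta>) / real n + 3 * sqrt (1 / real n) / ln b"
  proof -
    have "prob (C j) \<le> 1 / real n" using C(3)[of j] n by (simp add: field_simps)
    then have "3 * sqrt (prob (C j)) / ln b \<le> 3 * sqrt (1 / real n) / ln b"
      using lnb by (intro divide_right_mono mult_left_mono) auto
    then show ?thesis
      using j(2) neg_log_le_sqrt[of "prob (C j)"] neg_log_compl_le_sqrt[of "prob (C j)"]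
      unfolding \<gamma>_def by (simp add: add_divide_distrib)
  qed
  obtain F0 where F0: "F0 \<in> selectors M \<U>"
    using U selector_exists[of \<U> M] by (auto simp: is_cover_def)
  then have sF0: "simple_function M F0" by (simp add: selectors_def)
  define E where "E = {y \<in> long_period m. \<forall>t<n. (T_inv ^^ t) y \<notin> C j}"
  have E: "E \<in> sets M"
  proof -
    have [measurable]: "C j \<in> sets M" "\<And>t. (\<lambda>x. (T_inv ^^ t) x) \<in> measurable M M"
      "long_period m \<in> sets M"
      using C(1) T_inv_iter_measurable long_period_sets by auto
    have "E = {y \<in> space M. y \<in> long_period m \<and> (\<forall>t<n. (T_inv ^^ t) y \<notin> C j)}"
      unfolding E_def long_period_def by auto
    also have "\<dots> \<in> sets M" by measurable
    finally show ?thesis .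
  qed
  define \<eta> where "\<eta> = masked E F0"
  define \<zeta> where "\<zeta> = masked (space M - long_period m) F0"
  have s\<eta>: "simple_function M \<eta>" unfolding \<eta>_def by (rule simple_function_masked[OF sF0 E])
  have s\<zeta>: "simple_function M \<zeta>"
    unfolding \<zeta>_def using long_period_sets by (intro simple_function_masked sF0) auto
  have H\<eta>: "\<H>(\<eta>) \<le> (2 * real (card \<U>) + 1) * sqrt (1 / real n) / ln b"
  proof -
    have "real (m + 1) = 2 * (real n)\<^sup>2" using n by (simp add: m_def of_nat_diff)
    then have "prob E \<le> 1 / real n"
      using C(4)[OF j(1)] n by (simp add: E_def power2_eq_square)
    moreover have "card (F0 ` space M) \<le> card \<U>"
      using U F0 by (intro card_mono) (auto simp: is_cover_def selectors_def)
    ultimately have "(2 * real (card (F0 ` space M)) + 1) * sqrt (prob E) / ln b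
        \<le> (2 * real (card \<U>) + 1) * sqrt (1 / real n) / ln b"
      using lnb by (intro divide_right_mono mult_mono) auto
    then show ?thesis using entropy_masked_le[OF sF0 E] unfolding \<eta>_def by linarith
  qed
  have "\<forall>V\<in>iter_join M T \<U> n. \<exists>u. (\<forall>t<n. u t \<in> \<U>) \<and> (\<forall>x\<in>V. \<forall>t<n. (T ^^ t) x \<in> u t)"
  proof
    fix V assume "V \<in> iter_join M T \<U> n"
    then obtain u where "\<forall>t<n. u t \<in> \<U>" "V = {x \<in> space M. \<forall>t<n. (T ^^ t) x \<in> u t}"
      unfolding iter_join_iff by blast
    then show "\<exists>u. (\<forall>t<n. u t \<in> \<U>) \<and> (\<forall>x\<in>V. \<forall>t<n. (T ^^ t) x \<in> u t)"
      by (intro exI[of _ u]) simp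
  qed
  from bchoice[OF this] obtain u where u0: "\<forall>V\<in>iter_join M T \<U> n.
      (\<forall>t<n. u V t \<in> \<U>) \<and> (\<forall>x\<in>V. \<forall>t<n. (T ^^ t) x \<in> u V t)" ..
  have u: "u V t \<in> \<U>" "\<And>x. x \<in> V \<Longrightarrow> (T ^^ t) x \<in> u V t"
    if "V \<in> iter_join M T \<U> n" "t < n" for V t
    using bspec[OF u0 that(1)] that(2) by simp_all
  \<comment> \<open>\<open>ph y\<close> is the height of a point \<open>y\<close> of the tower, so \<open>y\<close> is to be put into the \<open>ph y\<close>-th set of the
    sequence which \<open>\<beta>\<close> chooses at the point of the base below \<open>y\<close>.\<close>
  define ph where "ph y = (LEAST t. t < n \<and> \<gamma> ((T_inv ^^ t) y) \<noteq> None)" for y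
  define \<sigma> where "\<sigma> y = (if \<exists>t<n. \<gamma> ((T_inv ^^ t) y) \<noteq> None
    then u (the (\<gamma> ((T_inv ^^ ph y) y))) (ph y) else F0 y)" for y
  have det: "\<sigma> x = \<sigma> y" if xy: "x \<in> space M" "y \<in> space M"
    and eq: "\<And>t. t < n \<Longrightarrow> \<gamma> ((T_inv ^^ t) x) = \<gamma> ((T_inv ^^ t) y)" "\<eta> x = \<eta> y" "\<zeta> x = \<zeta> y" for x y
  proof (cases "\<exists>t<n. \<gamma> ((T_inv ^^ t) x) \<noteq> None")
    case True
    have "(\<lambda>t. t < n \<and> \<gamma> ((T_inv ^^ t) x) \<noteq> None) = (\<lambda>t. t < n \<and> \<gamma> ((T_inv ^^ t) y) \<noteq> None)"
      using eq(1) by auto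
    then have ph_eq: "ph x = ph y" by (simp only: ph_def)
    have "ph x < n" unfolding ph_def using LeastI_ex[OF True] by simp
    then show ?thesis using True eq(1) ph_eq unfolding \<sigma>_def by auto
  next
    case False
    have none: "\<gamma> z = None \<longleftrightarrow> z \<notin> C j" for z by (simp add: \<gamma>_def masked_def)
    have no: "\<forall>t<n. (T_inv ^^ t) x \<notin> C j" using False none by simp
    have "F0 x = F0 y"
    proof (cases "x \<in> long_period m")
      case True
      then have "x \<in> E" using no by (simp add: E_def)
      then show ?thesis using eq(2) by (auto simp: \<eta>_def masked_def split: if_splits)
    next
      case False
      then show ?thesis using eq(3) xy by (auto simp: \<zeta>_def masked_def split: if_splits)
    qed
    moreover have "\<sigma> x = F0 x" "\<sigma> y = F0 y"
      using False eq(1) unfolding \<sigma>_def by auto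
    ultimately show ?thesis by simp
  qed
  have "simple_function M (\<lambda>x. (itinerary T_inv \<gamma> n x, \<eta> x, \<zeta> x))"
    by (intro simple_function_Pair s\<eta> s\<zeta> simple_function_itinerary[OF s\<gamma> T_inv_iter_measurable])
  then have s\<sigma>: "simple_function M \<sigma>"
  proof (rule simple_function_determined)
    fix x y assume "x \<in> space M" "y \<in> space M"
      "(itinerary T_inv \<gamma> n x, \<eta> x, \<zeta> x) = (itinerary T_inv \<gamma> n y, \<eta> y, \<zeta> y)"
    then show "\<sigma> x = \<sigma> y" by (intro det) (auto simp: itinerary_eq_iff)
  qed
  have "\<sigma> \<in> selectors M \<U>"
  proof -
    have "y \<in> \<sigma> y \<and> \<sigma> y \<in> \<U>" if y: "y \<in> space M" for y
    proof (cases "\<exists>t<n. \<gamma> ((T_inv ^^ t) y) \<noteq> None")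
      case True
      define x where "x = (T_inv ^^ ph y) y"
      have ph: "ph y < n" "\<gamma> x \<noteq> None" using LeastI_ex[OF True] by (auto simp: ph_def x_def)
      have x: "x \<in> space M" unfolding x_def by (rule T_inv_iter_space[OF y])
      have "the (\<gamma> x) = \<beta> x" using ph(2) by (auto simp: \<gamma>_def masked_def split: if_splits)
      then have \<sigma>y: "\<sigma> y = u (\<beta> x) (ph y)" using True by (simp add: \<sigma>_def x_def)
      have \<beta>x: "\<beta> x \<in> iter_join M T \<U> n" "x \<in> \<beta> x" using \<beta> x by (auto simp: selectors_def)
      have "(T ^^ ph y) x = y" unfolding x_def by (rule T_iter_inv_cancel[OF y])
      then show ?thesis unfolding \<sigma>y using u(1)[OF \<beta>x(1) ph(1)] u(2)[OF \<beta>x(1) ph(1) \<beta>x(2)] by simp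
    next
      case False
      then have "\<sigma> y = F0 y" by (simp only: \<sigma>_def if_False)
      then show ?thesis using F0 y by (auto simp: selectors_def)
    qed
    then show ?thesis using s\<sigma> by (simp add: selectors_def)
  qed
  then have "h_plus b M T \<U> \<le> dyn_entropy b M T (fibres M \<sigma>)" by (rule h_plus_le_selector[OF U])
  also have "\<dots> \<le> \<H>(\<gamma>) + \<H>(\<eta>)"
  proof -
    define K where "K = \<H>(itinerary T \<zeta> (fact m))"
    have per: "\<zeta> ((T ^^ fact m) x) = \<zeta> x" if x: "x \<in> space M" for x
      using long_period_iter[OF x, of "fact m" m] iter_fact_short_period[OF x, of m] iter_space[OF x] x
      by (auto simp: \<zeta>_def masked_def)
    have bound: "\<H>(itinerary T \<sigma> N) \<le> real (N + n) * (\<H>(\<gamma>) + \<H>(\<eta>)) + K" for N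
    proof -
      let ?Z = "\<lambda>x. (itinerary T \<gamma> (N + n) x, itinerary T \<eta> (N + n) x, itinerary T \<zeta> (N + n) x)"
      have sZ: "simple_function M ?Z" by (intro simple_function_Pair simple_itinerary s\<gamma> s\<eta> s\<zeta>)
      \<comment> \<open>\<open>\<sigma>\<close> looks at most \<open>n - 1\<close> steps into the past; shifting by \<open>n\<close> makes these times nonnegative.\<close>
      have "\<H>(itinerary T \<sigma> N) = \<H>(\<lambda>x. itinerary T \<sigma> N ((T ^^ n) x))"
        by (rule entropy_iter[symmetric]) (rule simple_itinerary[OF s\<sigma>])
      also have "\<dots> \<le> \<H>(?Z)"
      proof (rule entropy_determined[OF sZ])
        fix x y assume x: "x \<in> space M" and y: "y \<in> space M" and eq: "?Z x = ?Z y"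
        have eqs: "\<gamma> ((T ^^ i) x) = \<gamma> ((T ^^ i) y)" "\<eta> ((T ^^ i) x) = \<eta> ((T ^^ i) y)"
          "\<zeta> ((T ^^ i) x) = \<zeta> ((T ^^ i) y)" if "i < N + n" for i
          using eq that by (auto simp: itinerary_eq_iff)
        have "\<sigma> ((T ^^ (i + n)) x) = \<sigma> ((T ^^ (i + n)) y)" if i: "i < N" for i
        proof (rule det)
          show "(T ^^ (i + n)) x \<in> space M" "(T ^^ (i + n)) y \<in> space M"
            using iter_space x y by blast+
          show "\<eta> ((T ^^ (i + n)) x) = \<eta> ((T ^^ (i + n)) y)" "\<zeta> ((T ^^ (i + n)) x) = \<zeta> ((T ^^ (i + n)) y)"
            using eqs i by auto
          fix t assume t: "t < n"
          then have "t \<le> i + n" by simp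
          then show "\<gamma> ((T_inv ^^ t) ((T ^^ (i + n)) x)) = \<gamma> ((T_inv ^^ t) ((T ^^ (i + n)) y))"
            unfolding T_inv_iter_le[OF x \<open>t \<le> i + n\<close>] T_inv_iter_le[OF y \<open>t \<le> i + n\<close>]
            using eqs(1)[of "i + n - t"] i by simp
        qed
        then show "itinerary T \<sigma> N ((T ^^ n) x) = itinerary T \<sigma> N ((T ^^ n) y)"
          by (simp add: itinerary_eq_iff funpow_funpow)
      qed
      also have "\<dots> \<le> \<H>(itinerary T \<gamma> (N + n)) + \<H>(\<lambda>x. (itinerary T \<eta> (N + n) x, itinerary T \<zeta> (N + n) x))"
        by (intro entropy_pair_le simple_function_Pair simple_itinerary s\<gamma> s\<eta> s\<zeta>)
      also have "\<H>(\<lambda>x. (itinerary T \<eta> (N + n) x, itinerary T \<zeta> (N + n) x))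
          \<le> \<H>(itinerary T \<eta> (N + n)) + \<H>(itinerary T \<zeta> (N + n))"
        by (intro entropy_pair_le simple_itinerary s\<eta> s\<zeta>)
      also have "\<H>(itinerary T \<gamma> (N + n)) \<le> real (N + n) * \<H>(\<gamma>)" by (rule entropy_itinerary_le[OF s\<gamma>])
      also have "\<H>(itinerary T \<eta> (N + n)) \<le> real (N + n) * \<H>(\<eta>)" by (rule entropy_itinerary_le[OF s\<eta>])
      also have "\<H>(itinerary T \<zeta> (N + n)) \<le> K"
        unfolding K_def by (rule entropy_itinerary_periodic[OF s\<zeta> _ per]) simp_all
      finally show ?thesis by (simp add: algebra_simps)
    qed
    define A where "A = \<H>(\<gamma>) + \<H>(\<eta>)"
    have "(\<lambda>N. A + (real n * A + K) / real N) \<longlonglongrightarrow> A + 0"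
      by (intro tendsto_intros lim_const_over_n)
    moreover have "\<H>(itinerary T \<sigma> N) / real N \<le> A + (real n * A + K) / real N" if "N \<ge> 1" for N
      using bound[of N] that unfolding A_def[symmetric] by (simp add: field_simps)
    ultimately show ?thesis
      unfolding A_def[symmetric]
      using LIMSEQ_le[OF dyn_entropy_limit[OF labels_fibres[OF s\<sigma>]], of _ "A + 0"] by auto
  qed
  also have "\<dots> \<le> \<H>(\<beta>) / real n + (2 * real (card \<U>) + 4) * (sqrt (1 / real n) / ln b)"
    using H\<gamma> H\<eta> by (simp add: algebra_simps add_divide_distrib)
  also have "sqrt (1 / real n) / ln b = 1 / (sqrt (real n) * ln b)" by (simp add: real_sqrt_divide)
  finally show ?thesis by simp
qed

text \<open>A nearly optimal \<open>\<beta>\<close> in the block code turns entropies of iterated joins into bounds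
  for \<open>h_plus\<close>. An error of \<open>1\<close> in the entropy of \<open>\<beta>\<close> is harmless as it is divided by
  \<open>n\<close>.\<close>

lemma h_plus_le_h_minus:
  assumes U: "is_cover M \<U>" shows "h_plus b M T \<U> \<le> h_minus b M T \<U>"
proof -
  let ?H = "\<lambda>n. cover_entropy b M (iter_join M T \<U> n)"
  define c where "c = (2 * real (card \<U>) + 4) / ln b"
  have "h_plus b M T \<U> \<le> ?H n / real n + 1 / real n + c / sqrt (real n)" if n: "n \<ge> 1" for n
  proof -
    obtain \<beta> where \<beta>: "\<beta> \<in> selectors M (iter_join M T \<U> n)" "\<H>(\<beta>) < ?H n + 1"
      using selector_near_cover_entropy[OF is_cover_iter_join[OF U] zero_less_one] .
    have "h_plus b M T \<U> \<le> \<H>(\<beta>) / real n + c / sqrt (real n)"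
      using h_plus_le_block_code[OF U _ \<beta>(1)] n by (simp add: c_def mult.commute)
    also have "\<H>(\<beta>) / real n \<le> (?H n + 1) / real n" using \<beta>(2) by (intro divide_right_mono) auto
    finally show ?thesis by (simp add: add_divide_distrib)
  qed
  moreover have "(\<lambda>n. ?H n / real n + 1 / real n + c / sqrt (real n)) \<longlonglongrightarrow> h_minus b M T \<U> + 0 + 0"
  proof (intro tendsto_add h_minus_limit[OF U] lim_const_over_n)
    show "(\<lambda>n. c / sqrt (real n)) \<longlonglongrightarrow> 0"
      by (intro tendsto_divide_0[OF tendsto_const] filterlim_at_top_imp_at_infinity
          filterlim_compose[OF sqrt_at_top filterlim_real_sequentially])
  qed
  ultimately show ?thesis
    using LIMSEQ_le_const[of _ "h_minus b M T \<U>" "h_plus b M T \<U>"] by auto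
qed

end

theorem theorem6p1:
  fixes M :: "'a measure" and T :: "'a \<Rightarrow> 'a" and \<U> :: "'a set set" and b :: real
  assumes "b > 1"
    and "measure_dynamical_system M T"
    and "is_cover M \<U>"
  shows "h_mu b M T \<U> \<le> h_c b M T \<U>"
proof -
  interpret measure_dynamical_system M T by fact
  interpret entropy_system M T b by unfold_locales fact
  have "h_plus b M T \<U> = h_minus b M T \<U>"
    using h_plus_le_h_minus[OF assms(3)] h_minus_le_h_plus[OF assms(3)] by (rule antisym)
  then have "h_mu b M T \<U> = h_minus b M T \<U>" unfolding h_mu_def by simp
  then show ?thesis using h_minus_le_h_c[OF assms(3)] by simp
qed

end
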